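(* There exists a universal constant $C$ such that for every Bruno number $\omega>0$, $$\log d_\omega\ge-B(\omega)-C,$$ where $B(\omega)$ is the value of the Bruno function at $\omega$.
   Context: Let $\mathbb{D}\subset\mathbb{C}$ be the unit disk. For $\omega>0$, $\mathcal{F}_\omega$ is the family of analytic vector fields $\mathbf{F}=(F_1,F_2):\mathbb{D}\times\mathbb{D}\to\mathbb{C}^2$ of the form $$F_1(z_1,z_2)=-z_1+\sum_{|\alpha|\ge2}f_{\alpha,1}z^\alpha,\qquad F_2(z_1,z_2)=\omega z_2+\sum_{|\alpha|\ge2}f_{\alpha,2}z^\alpha,$$ with $|f_{\alpha,j}|\le1$ for all $\alpha\in\mathbb{N}^2$, $|\alpha|=\alpha_1+\alpha_2\ge2$, $j=1,2$. For $\mathbf{F}\in\mathcal{F}_\omega$ and $A=\mathrm{diag}(-1,\omega)$ with $\omega$ irrational, the linearization of $\mathbf{F}$ is the unique formal power series $\mathbf{h}\in\mathbb{C}^2[[w_1,w_2]]$ without terms of degree $\le1$ such that the change of variables $\mathbf{z}=\mathbf{w}+\mathbf{h}(\mathbf{w})$ transforms $\dot{\mathbf{z}}=\mathbf{F}(\mathbf{z})$ into $\dot{\mathbf{w}}=A\mathbf{w}$. Let $\mathcal{R}_0$ be the complete Reinhardt domain of center $0$ which is the domain of convergence of the power series $\mathbf{h}$, and let $$d_{\mathbf{F}}=\inf_{(z_1,z_2)\in\partial\mathcal{R}_0}(|z_1|^2+|z_2|^2)^{1/2}$$ be the distance of the origin to its boundary ($+\infty$ if the boundary is empty, $0$ if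 there is no neighbourhood of the origin where $\mathbf{h}$ converges). Set $d_\omega=\inf_{\mathbf{F}\in\mathcal{F}_\omega}d_{\mathbf{F}}$. Bruno numbers and Bruno function: an irrational $\omega$ is a Bruno number if $\sum_{k\ge0}\frac{\log q_{k+1}}{q_k}<+\infty$, where $(q_k)_k$ are the denominators of the convergents of the continued fraction of $\omega$. The Bruno function $B$ (Marmi–Moussa–Yoccoz) is the $1$-periodic function satisfying $B(x)=-\log x+xB(1/x)$ for irrational $x\in(0,1)$; explicitly, with $x_0=\omega-\lfloor\omega\rfloor$, $x_{j+1}=1/x_j-\lfloor1/x_j\rfloor$, $\beta_{-1}=1$, $\beta_j=x_0x_1\cdots x_j$, one has $B(\omega)=-\sum_{j\ge0}\beta_{j-1}\log x_j$, which is finite exactly when $\omega$ is a Bruno number. *)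

theory Defs
  imports "HOL-Analysis.Analysis" "HOL-Computational_Algebra.Formal_Power_Series"
begin

text \<open>
  The ring of formal power series in two variables is rendered as iterated power series: the
  coefficient of the monomial with exponents \<open>(m, n)\<close> in \<open>H\<close> is \<open>coeff2 H m n\<close>, the outer variable
  being the first one.
\<close>

type_synonym fps2 = "complex fps fps"

definition coeff2 :: "fps2 \<Rightarrow> nat \<Rightarrow> nat \<Rightarrow> complex" where
  "coeff2 H m n = fps_nth (fps_nth H m) n"

definition const2 :: "complex \<Rightarrow> fps2" where
  "const2 c = fps_const (fps_const c)"

definition var1 :: fps2 where
  "var1 = fps_X"

definition var2 :: fps2 where
  "var2 = fps_const fps_X"

definition pderiv1 :: "fps2 \<Rightarrow> fps2" where
  "pderiv1 H = fps_deriv H"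

definition pderiv2 :: "fps2 \<Rightarrow> fps2" where
  "pderiv2 H = Abs_fps (\<lambda>m. fps_deriv (fps_nth H m))"

text \<open>
  Substitution \<open>f(g1, g2)\<close>, meaningful when \<open>g1\<close> and \<open>g2\<close> have no constant term: then
  \<open>g1 ^ a * g2 ^ b\<close> has no terms of degree less than \<open>a + b\<close>, so only the finitely many \<open>(a, b)\<close>
  with \<open>a + b \<le> m + n\<close> contribute to the coefficient with exponents \<open>(m, n)\<close>.
\<close>

definition subst2 :: "fps2 \<Rightarrow> fps2 \<Rightarrow> fps2 \<Rightarrow> fps2" where
  "subst2 f g1 g2 = Abs_fps (\<lambda>m. Abs_fps (\<lambda>n.
     \<Sum>(a, b) | a + b \<le> m + n. coeff2 f a b * coeff2 (g1 ^ a * g2 ^ b) m n))"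

definition has_expansion :: "(complex \<times> complex \<Rightarrow> complex) \<Rightarrow> fps2 \<Rightarrow> bool" where
  "has_expansion G g \<longleftrightarrow>
     (\<forall>z1 z2. norm z1 < 1 \<longrightarrow> norm z2 < 1 \<longrightarrow>
        ((\<lambda>(m, n). coeff2 g m n * z1 ^ m * z2 ^ n) has_sum G (z1, z2)) UNIV)"

text \<open>
  Vector fields are total functions here, but only their values on the bidisk matter.
  Analyticity on the bidisk is part of \<^const>\<open>has_expansion\<close>.
\<close>

definition vector_fields :: "real \<Rightarrow> (complex \<times> complex \<Rightarrow> complex \<times> complex) set" where
  "vector_fields \<omega> = {F. \<exists>f1 f2.
     has_expansion (\<lambda>z. fst (F z)) f1 \<and> has_expansion (\<lambda>z. snd (F z)) f2 \<and>
     coeff2 f1 0 0 = 0 \<and> coeff2 f1 1 0 = -1 \<and> coeff2 f1 0 1 = 0 \<and>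
     coeff2 f2 0 0 = 0 \<and> coeff2 f2 1 0 = 0 \<and> coeff2 f2 0 1 = of_real \<omega> \<and>
     (\<forall>m n. m + n \<ge> 2 \<longrightarrow> norm (coeff2 f1 m n) \<le> 1 \<and> norm (coeff2 f2 m n) \<le> 1)}"

text \<open>
  If \<open>z = \<Phi>(w) = w + h(w)\<close> and \<open>w' = A w\<close> with \<open>A = diag (-1, \<omega>)\<close>, then \<open>z' = D\<Phi>(w) A w\<close>; so the
  change of variables transforms \<open>z' = F(z)\<close> into \<open>w' = A w\<close> iff \<open>D\<Phi>(w) A w = F(\<Phi>(w))\<close> as formal
  power series. The left-hand side is \<open>\<Phi>\<close> differentiated along the vector field \<open>A w\<close>.
\<close>

definition deriv_along :: "real \<Rightarrow> fps2 \<Rightarrow> fps2" where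
  "deriv_along \<omega> \<Phi> =
     pderiv1 \<Phi> * (const2 (-1) * var1) + pderiv2 \<Phi> * (const2 (of_real \<omega>) * var2)"

definition is_linearization ::
  "real \<Rightarrow> (complex \<times> complex \<Rightarrow> complex \<times> complex) \<Rightarrow> fps2 \<times> fps2 \<Rightarrow> bool" where
  "is_linearization \<omega> F h \<longleftrightarrow> (case h of (h1, h2) \<Rightarrow>
     (\<forall>m n. m + n \<le> 1 \<longrightarrow> coeff2 h1 m n = 0 \<and> coeff2 h2 m n = 0) \<and>
     (\<exists>f1 f2. has_expansion (\<lambda>z. fst (F z)) f1 \<and> has_expansion (\<lambda>z. snd (F z)) f2 \<and>
        deriv_along \<omega> (var1 + h1) = subst2 f1 (var1 + h1) (var2 + h2) \<and>
        deriv_along \<omega> (var2 + h2) = subst2 f2 (var1 + h1) (var2 + h2)))"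

definition linearization ::
  "real \<Rightarrow> (complex \<times> complex \<Rightarrow> complex \<times> complex) \<Rightarrow> fps2 \<times> fps2" where
  "linearization \<omega> F = (THE h. is_linearization \<omega> F h)"

text \<open>
  The domain of convergence is the interior of the set of points of convergence. Summability over
  the unordered index set \<open>\<nat> \<times> \<nat>\<close> is absolute convergence.
\<close>

definition convergence_domain :: "fps2 \<times> fps2 \<Rightarrow> (complex \<times> complex) set" where
  "convergence_domain h = interior {(z1, z2).
     (\<lambda>(m, n). coeff2 (fst h) m n * z1 ^ m * z2 ^ n) summable_on UNIV \<and>
     (\<lambda>(m, n). coeff2 (snd h) m n * z1 ^ m * z2 ^ n) summable_on UNIV}"

text \<open>
  The norm on pairs is the Euclidean one, and the infimum of the empty set is \<open>\<infinity>\<close>. The domain of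
  convergence contains the origin iff the series converges on some neighbourhood of it.
\<close>

definition boundary_dist ::
  "real \<Rightarrow> (complex \<times> complex \<Rightarrow> complex \<times> complex) \<Rightarrow> ereal" where
  "boundary_dist \<omega> F =
     (let R = convergence_domain (linearization \<omega> F)
      in if (0, 0) \<in> R then (INF z \<in> frontier R. ereal (norm z)) else 0)"

definition family_dist :: "real \<Rightarrow> ereal" where
  "family_dist \<omega> = (INF F \<in> vector_fields \<omega>. boundary_dist \<omega> F)"

text \<open>The logarithm on \<open>[0, \<infinity>]\<close>, with \<open>log 0 = -\<infinity>\<close> and \<open>log \<infinity> = \<infinity>\<close>.\<close>

definition ereal_log :: "ereal \<Rightarrow> ereal" where
  "ereal_log x = (if x = \<infinity> then \<infinity> else if x \<le> 0 then -\<infinity> else ereal (ln (real_of_ereal x)))"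

primrec cf_rem :: "real \<Rightarrow> nat \<Rightarrow> real" where
  "cf_rem \<omega> 0 = frac \<omega>"
| "cf_rem \<omega> (Suc j) = frac (1 / cf_rem \<omega> j)"

text \<open>\<open>\<omega> = [a\<^sub>0; a\<^sub>1, a\<^sub>2, \<dots>]\<close> with \<open>a\<^sub>0 = \<lfloor>\<omega>\<rfloor>\<close> and \<open>a\<^sub>k\<^sub>+\<^sub>1 = \<lfloor>1 / x\<^sub>k\<rfloor>\<close>; the denominators of the
  convergents do not depend on \<open>a\<^sub>0\<close>.\<close>

fun cf_denom :: "real \<Rightarrow> nat \<Rightarrow> int" where
  "cf_denom \<omega> 0 = 1"
| "cf_denom \<omega> (Suc 0) = \<lfloor>1 / cf_rem \<omega> 0\<rfloor>"
| "cf_denom \<omega> (Suc (Suc k)) =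
     \<lfloor>1 / cf_rem \<omega> (Suc k)\<rfloor> * cf_denom \<omega> (Suc k) + cf_denom \<omega> k"

definition bruno_number :: "real \<Rightarrow> bool" where
  "bruno_number \<omega> \<longleftrightarrow> \<omega> \<notin> \<rat> \<and>
     summable (\<lambda>k. ln (real_of_int (cf_denom \<omega> (Suc k))) / real_of_int (cf_denom \<omega> k))"

text \<open>
  For irrational \<open>\<omega>\<close> all terms are positive, so the extended real sum always makes sense. The empty
  product at \<open>j = 0\<close> is \<open>\<beta>\<^sub>-\<^sub>1 = 1\<close>.
\<close>

definition bruno_function :: "real \<Rightarrow> ereal" where
  "bruno_function \<omega> = (\<Sum>j. ereal (- ((\<Prod>i<j. cf_rem \<omega> i) * ln (cf_rem \<omega> j))))"

end

theory Submission
  imports Defs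
begin

text \<open>
  Write \<open>\<Phi>(w) = w + h(w)\<close> and \<open>\<lambda> = (-1, \<omega>)\<close>. Comparing coefficients in the conjugacy equation, the
  coefficient of \<open>w\<^sup>\<alpha>\<close> in component \<open>j\<close> of \<open>\<Phi>\<close> is a sum of coefficients of products of at least two
  components of \<open>\<Phi>\<close>, taken with factors of modulus at most \<open>1\<close> and divided by the small divisor
  \<open>\<langle>\<lambda>, \<alpha>\<rangle> - \<lambda>\<^sub>j\<close>. Unfolding this recursion, a coefficient of degree \<open>n\<close> becomes a sum over trees with
  \<open>n\<close> leaves, each contributing the product of the inverse divisors at its inner nodes. The proof
  separates the two sources of growth. The largest product along a single tree is at most
  \<open>exp ((n - 1) (B(\<omega>) + C'))\<close>, by \<open>forest_cost_le\<close>. After division by this weight the recursion has no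
  divisors left and its solution converges on a fixed polydisc, by \<open>linearizes_weighted_sum_le\<close>.
  Together, \<open>h\<close> converges on the polydisc of radius \<open>exp (- B(\<omega>) - C)\<close>.

  For the product along a tree, let \<open>\<beta>\<^sub>k = x\<^sub>0 \<dots> x\<^sub>k\<close>. A divisor is of the form \<open>q \<omega> - p\<close>, and if it is
  smaller than \<open>\<beta>\<^sub>k\<^sub>-\<^sub>1\<close>, the theory of best approximations gives \<open>q \<ge> q\<^sub>k\<close>, so that the degree of the node
  exceeds \<open>q\<^sub>k\<close> (\<open>small_divisor_degree\<close>). The usual counting of Bruno deduces that a tree with \<open>n\<close>
  leaves has at most \<open>2n / q\<^sub>k\<close> such nodes, which would yield the bound with \<open>2 B(\<omega>)\<close>. To get the factor
  \<open>1\<close>, one uses that divisors are values of an additive function. Suppose that a node and the \<open>t\<close>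
  topmost nodes with small divisors below it all have divisors less than \<open>\<epsilon>\<close>. Cutting off the
  subtrees at these \<open>t\<close> nodes leaves a tree whose divisor is less than \<open>(t + 1) \<epsilon>\<close>. As long as
  \<open>(t + 1) \<epsilon> \<le> \<beta>\<^sub>k\<^sub>-\<^sub>1\<close>, this tree has more than \<open>q\<^sub>k\<close> leaves; and for larger \<open>t\<close> the many disjoint subtrees
  can share the cost of one more node. Hence at most \<open>(1 + 2 / 2\<^sup>i) n / q\<^sub>k\<close> divisors are below
  \<open>2\<^sup>-\<^sup>i \<beta>\<^sub>k\<^sub>-\<^sub>1\<close> (\<open>small_count_le\<close>).

  Each divisor is located by the dyadic thresholds between consecutive \<open>\<beta>\<^sub>k\<close>. There are about
  \<open>log (1 / x\<^sub>k) / log 2\<close> thresholds between \<open>\<beta>\<^sub>k\<^sub>-\<^sub>1\<close> and \<open>\<beta>\<^sub>k\<close>, so the logarithm of the product is at most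
  \<open>n \<Sum>\<^sub>k (log (1 / x\<^sub>k) + O(1)) / q\<^sub>k\<close> up to \<open>O(n)\<close>. Finally \<open>1 / q\<^sub>k \<le> \<beta>\<^sub>k\<^sub>-\<^sub>1 + \<beta>\<^sub>k\<close>, \<open>x log (1 / x) \<le> 1\<close> and
  \<open>\<Sum>\<^sub>k \<beta>\<^sub>k\<^sub>-\<^sub>1 \<le> 4\<close> turn the sum into \<open>B(\<omega>) + O(1)\<close> with a universal error.
\<close>

section \<open>Continued fractions\<close>

text \<open>
  This is \<open>\<beta>\<^sub>k\<^sub>-\<^sub>1\<close>: the index is shifted by one so that it starts with the empty product.
\<close>

definition cf_prod :: "real \<Rightarrow> nat \<Rightarrow> real" where
  "cf_prod \<omega> k = (\<Prod>i<k. cf_rem \<omega> i)"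

lemma cf_prod_0 [simp]: "cf_prod \<omega> 0 = 1"
  by (simp add: cf_prod_def)

lemma cf_prod_Suc: "cf_prod \<omega> (Suc k) = cf_prod \<omega> k * cf_rem \<omega> k"
  by (simp add: cf_prod_def)

lemma frac_irrational:
  assumes "(x::real) \<notin> \<rat>"
  shows "frac x \<notin> \<rat>" "0 < frac x" "frac x < 1"
proof -
  show irr: "frac x \<notin> \<rat>"
  proof
    assume "frac x \<in> \<rat>"
    then have "frac x + of_int \<lfloor>x\<rfloor> \<in> \<rat>" by (intro Rats_add) auto
    then show False using assms by (simp add: frac_def)
  qed
  show "0 < frac x"
    using irr frac_ge_0[of x] by (metis Rats_0 order_le_less)
  show "frac x < 1" by (rule frac_lt_1)
qed

lemma cf_rem_irrational:
  assumes "\<omega> \<notin> \<rat>"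
  shows "cf_rem \<omega> k \<notin> \<rat>"
proof (induction k)
  case 0
  show ?case using frac_irrational[OF assms] by simp
next
  case (Suc k)
  have "1 / cf_rem \<omega> k \<notin> \<rat>"
  proof
    assume "1 / cf_rem \<omega> k \<in> \<rat>"
    then have "inverse (1 / cf_rem \<omega> k) \<in> \<rat>" by (rule Rats_inverse)
    then show False using Suc by simp
  qed
  then show ?case using frac_irrational by simp
qed

lemma cf_rem_bounds:
  assumes "\<omega> \<notin> \<rat>"
  shows "0 < cf_rem \<omega> k" "cf_rem \<omega> k < 1"
proof -
  have "0 \<le> cf_rem \<omega> k \<and> cf_rem \<omega> k < 1"
    by (cases k) (auto simp: frac_ge_0 frac_lt_1)
  moreover have "cf_rem \<omega> k \<noteq> 0"
    using cf_rem_irrational[OF assms, of k] by (metis Rats_0)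
  ultimately show "0 < cf_rem \<omega> k" "cf_rem \<omega> k < 1" by auto
qed

lemma cf_quotient_pos:
  assumes "\<omega> \<notin> \<rat>"
  shows "1 \<le> \<lfloor>1 / cf_rem \<omega> k\<rfloor>"
  using cf_rem_bounds[OF assms, of k] by (simp add: le_floor_iff)

lemma cf_prod_pos: "\<omega> \<notin> \<rat> \<Longrightarrow> 0 < cf_prod \<omega> k"
  unfolding cf_prod_def by (intro prod_pos) (auto simp: cf_rem_bounds)

lemma cf_prod_antimono_Suc: "\<omega> \<notin> \<rat> \<Longrightarrow> cf_prod \<omega> (Suc k) \<le> cf_prod \<omega> k"
  using cf_prod_pos[of \<omega> k] cf_rem_bounds[of \<omega> k] by (simp add: cf_prod_Suc mult_left_le)

lemma cf_prod_le_1: "\<omega> \<notin> \<rat> \<Longrightarrow> cf_prod \<omega> k \<le> 1"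
proof (induction k)
  case (Suc k)
  then show ?case using cf_prod_antimono_Suc[of \<omega> k] by linarith
qed simp

lemma cf_prod_recurrence:
  assumes "\<omega> \<notin> \<rat>"
  shows "cf_prod \<omega> (Suc (Suc k)) = cf_prod \<omega> k - \<lfloor>1 / cf_rem \<omega> k\<rfloor> * cf_prod \<omega> (Suc k)"
  using cf_rem_bounds[OF assms, of k] by (simp add: cf_prod_Suc frac_def field_simps)

text \<open>
  Since the partial quotient is at least \<open>1\<close> and the products decrease, the subtracted term in the
  recurrence is at least as large as what remains.
\<close>

lemma cf_prod_halves:
  assumes "\<omega> \<notin> \<rat>"
  shows "2 * cf_prod \<omega> (Suc (Suc k)) \<le> cf_prod \<omega> k"
proof -
  have "cf_prod \<omega> (Suc (Suc k)) \<le> cf_prod \<omega> (Suc k)"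
    by (rule cf_prod_antimono_Suc[OF assms])
  also have "\<dots> \<le> \<lfloor>1 / cf_rem \<omega> k\<rfloor> * cf_prod \<omega> (Suc k)"
    using cf_quotient_pos[OF assms, of k] cf_prod_pos[OF assms, of "Suc k"] by simp
  finally show ?thesis using cf_prod_recurrence[OF assms, of k] by linarith
qed

text \<open>
  This bound, which does not depend on \<open>\<omega>\<close>, is what makes the final constant universal: an error of
  order \<open>\<beta>\<^sub>k\<^sub>-\<^sub>1\<close> is affordable at each scale \<open>k\<close>. The two extra summands in the proof make the
  induction go through.
\<close>

lemma sum_cf_prod_le:
  assumes "\<omega> \<notin> \<rat>"
  shows "(\<Sum>k<L. cf_prod \<omega> k) \<le> 4"
proof -
  have "(\<Sum>k<L. cf_prod \<omega> k) + 2 * cf_prod \<omega> L + 2 * cf_prod \<omega> (Suc L) \<le> 4"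
  proof (induction L)
    case 0
    show ?case using cf_prod_le_1[OF assms, of "Suc 0"] by simp
  next
    case (Suc L)
    then show ?case using cf_prod_halves[OF assms, of L] by simp
  qed
  then show ?thesis
    using cf_prod_pos[OF assms, of L] cf_prod_pos[OF assms, of "Suc L"] by linarith
qed

lemma cf_prod_tendsto_0:
  assumes "\<omega> \<notin> \<rat>"
  shows "cf_prod \<omega> \<longlonglongrightarrow> 0"
proof -
  have "summable (cf_prod \<omega>)"
    by (rule summableI_nonneg_bounded[where x = 4])
       (use cf_prod_pos[OF assms] sum_cf_prod_le[OF assms] in \<open>auto intro: less_imp_le\<close>)
  then show ?thesis by (rule summable_LIMSEQ_zero)
qed

lemma cf_denom_pos_mono:
  assumes "\<omega> \<notin> \<rat>"
  shows "1 \<le> cf_denom \<omega> k \<and> cf_denom \<omega> k \<le> cf_denom \<omega> (Suc k)"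
proof (induction k)
  case 0
  show ?case using cf_quotient_pos[OF assms, of 0] by simp
next
  case (Suc k)
  have "1 * cf_denom \<omega> (Suc k) \<le> \<lfloor>1 / cf_rem \<omega> (Suc k)\<rfloor> * cf_denom \<omega> (Suc k)"
    using Suc cf_quotient_pos[OF assms, of "Suc k"] by (intro mult_right_mono) auto
  then show ?case using Suc unfolding cf_denom.simps by linarith
qed

lemma cf_denom_prod_identity:
  assumes "\<omega> \<notin> \<rat>"
  shows "cf_denom \<omega> (Suc k) * cf_prod \<omega> (Suc k) + cf_denom \<omega> k * cf_prod \<omega> (Suc (Suc k)) = 1"
proof (induction k)
  case 0
  show ?case using cf_prod_recurrence[OF assms, of 0] by simp
next
  case (Suc k)
  let ?a = "\<lfloor>1 / cf_rem \<omega> (Suc k)\<rfloor>"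
  have "real_of_int (cf_denom \<omega> (Suc (Suc k))) * cf_prod \<omega> (Suc (Suc k))
      + cf_denom \<omega> (Suc k) * cf_prod \<omega> (Suc (Suc (Suc k)))
    = cf_denom \<omega> (Suc k) * (cf_prod \<omega> (Suc (Suc (Suc k))) + ?a * cf_prod \<omega> (Suc (Suc k)))
      + cf_denom \<omega> k * cf_prod \<omega> (Suc (Suc k))"
    by (simp add: algebra_simps del: cf_rem.simps)
  also have "cf_prod \<omega> (Suc (Suc (Suc k))) + ?a * cf_prod \<omega> (Suc (Suc k)) = cf_prod \<omega> (Suc k)"
    using cf_prod_recurrence[OF assms, of "Suc k"] by simp
  finally show ?case using Suc by simp
qed

text \<open>
  The counting argument naturally produces the factors \<open>1 / q\<^sub>k\<close>, the Bruno function the factors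
  \<open>\<beta>\<^sub>k\<^sub>-\<^sub>1\<close>. The excess \<open>\<beta>\<^sub>k = x\<^sub>k \<beta>\<^sub>k\<^sub>-\<^sub>1\<close> is harmless even against \<open>log (1 / x\<^sub>k)\<close>.
\<close>

lemma inverse_cf_denom_le:
  assumes "\<omega> \<notin> \<rat>"
  shows "1 / cf_denom \<omega> k \<le> cf_prod \<omega> k + cf_prod \<omega> (Suc k)"
proof (cases k)
  case 0
  then show ?thesis using cf_prod_pos[OF assms, of "Suc 0"] by simp
next
  case (Suc l)
  have "1 = cf_denom \<omega> k * cf_prod \<omega> k + cf_denom \<omega> l * cf_prod \<omega> (Suc k)"
    using cf_denom_prod_identity[OF assms, of l] Suc by simp
  also have "\<dots> \<le> cf_denom \<omega> k * cf_prod \<omega> k + cf_denom \<omega> k * cf_prod \<omega> (Suc k)"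
    using cf_denom_pos_mono[OF assms, of l] cf_prod_pos[OF assms, of "Suc k"] Suc
    by (intro add_left_mono mult_right_mono) auto
  finally show ?thesis
    using cf_denom_pos_mono[OF assms, of k] by (simp add: field_simps)
qed

text \<open>
  Consecutive convergents form a basis of \<open>\<int>\<^sup>2\<close>. Working with the values of the linear form
  \<open>q x\<^sub>0 - p\<close> on them, which are \<open>\<plusminus>\<beta>\<^sub>k\<close> with alternating signs, avoids introducing the numerators.
\<close>

lemma cf_lattice_basis:
  assumes "\<omega> \<notin> \<rat>"
  shows "\<exists>u v :: int. q = u * cf_denom \<omega> (Suc k) + v * cf_denom \<omega> k \<and>
     real_of_int q * frac \<omega> - real_of_int p
       = (-1) ^ Suc k * (u * cf_prod \<omega> (Suc (Suc k)) - v * cf_prod \<omega> (Suc k))"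
proof (induction k)
  case 0
  let ?a = "\<lfloor>1 / frac \<omega>\<rfloor>"
  have b: "cf_prod \<omega> (Suc (Suc 0)) = 1 - ?a * frac \<omega>" "cf_prod \<omega> (Suc 0) = frac \<omega>"
    using cf_prod_recurrence[OF assms, of 0] by (simp_all add: cf_prod_Suc)
  show ?case
    by (intro exI[where P = "\<lambda>u. \<exists>v. _ u v" and x = p] exI[of _ "q - ?a * p"])
       (simp add: b algebra_simps)
next
  case (Suc k)
  then obtain u v :: int where uv: "q = u * cf_denom \<omega> (Suc k) + v * cf_denom \<omega> k"
    "real_of_int q * frac \<omega> - real_of_int p
       = (-1) ^ Suc k * (u * cf_prod \<omega> (Suc (Suc k)) - v * cf_prod \<omega> (Suc k))"
    by auto
  let ?a = "\<lfloor>1 / cf_rem \<omega> (Suc k)\<rfloor>"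
  have b: "cf_prod \<omega> (Suc k) = cf_prod \<omega> (Suc (Suc (Suc k))) + ?a * cf_prod \<omega> (Suc (Suc k))"
    using cf_prod_recurrence[OF assms, of "Suc k"] by simp
  show ?case
  proof (intro exI conjI)
    show "q = v * cf_denom \<omega> (Suc (Suc k)) + (u - ?a * v) * cf_denom \<omega> (Suc k)"
      using uv(1) by (simp add: algebra_simps)
    show "real_of_int q * frac \<omega> - real_of_int p = (-1) ^ Suc (Suc k) *
        (v * cf_prod \<omega> (Suc (Suc (Suc k))) - real_of_int (u - ?a * v) * cf_prod \<omega> (Suc (Suc k)))"
      unfolding uv(2) b by (simp add: algebra_simps)
  qed
qed

text \<open>
  For \<open>0 < q < q\<^sub>k\<close>, the second coordinate with respect to the basis is nonzero and the two coordinates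
  do not have the same strict sign. As the signs of the form on the basis alternate, the contributions to the linear form do not cancel and it is at least \<open>\<beta>\<^sub>k\<^sub>-\<^sub>1\<close>.
\<close>

lemma best_approximation_frac:
  assumes "\<omega> \<notin> \<rat>" "1 \<le> q" "\<bar>real_of_int q * frac \<omega> - real_of_int p\<bar> < cf_prod \<omega> k"
  shows "cf_denom \<omega> k \<le> q"
proof (cases k)
  case 0
  then show ?thesis using assms(2) by simp
next
  case (Suc l)
  obtain u v :: int where uv: "q = u * cf_denom \<omega> (Suc l) + v * cf_denom \<omega> l"
    "real_of_int q * frac \<omega> - real_of_int p
       = (-1) ^ Suc l * (u * cf_prod \<omega> (Suc (Suc l)) - v * cf_prod \<omega> (Suc l))"
    using cf_lattice_basis[OF assms(1)] by metis
  define A where "A = cf_denom \<omega> (Suc l)"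
  define B where "B = cf_denom \<omega> l"
  define b where "b = cf_prod \<omega> (Suc (Suc l))"
  define c where "c = cf_prod \<omega> (Suc l)"
  have pos: "1 \<le> A" "1 \<le> B" "0 < b" "0 < c"
    using cf_denom_pos_mono[OF assms(1)] cf_prod_pos[OF assms(1)]
    by (simp_all add: A_def B_def b_def c_def)
  have q: "q = u * A + v * B" using uv by (simp add: A_def B_def)
  have lt: "\<bar>u * b - v * c\<bar> < c"
    using assms(3) unfolding uv(2) Suc
    by (simp only: abs_mult power_abs b_def c_def) simp
  consider "v = 0" | "v \<ge> 1" "u \<le> 0" | "v \<ge> 1" "u \<ge> 1" | "v \<le> -1" "u \<ge> 0" | "v \<le> -1" "u \<le> -1"
    by linarith
  then have "A \<le> q"
  proof cases
    case 1
    have "u \<ge> 1"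
    proof (rule ccontr)
      assume "\<not> u \<ge> 1"
      then have "u * A \<le> 0" using pos by (intro mult_nonpos_nonneg) auto
      then show False using q 1 assms(2) by simp
    qed
    then have "1 * A \<le> u * A" using pos by (intro mult_right_mono) auto
    then show ?thesis using q 1 by simp
  next
    case 2
    have "u * b \<le> 0" using 2 pos by (intro mult_nonpos_nonneg) auto
    moreover have "1 * c \<le> v * c" using 2 pos by (intro mult_right_mono) auto
    ultimately show ?thesis using lt by linarith
  next
    case 3
    have "1 * A \<le> u * A" "0 \<le> v * B" using 3 pos by (intro mult_right_mono mult_nonneg_nonneg; simp)+
    then show ?thesis using q by simp
  next
    case 4
    have "0 \<le> u * b" using 4 pos by (intro mult_nonneg_nonneg) auto
    moreover have "v * c \<le> (-1) * c" using 4 pos by (intro mult_right_mono) auto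
    ultimately show ?thesis using lt by linarith
  next
    case 5
    have "u * A \<le> 0" "v * B \<le> 0" using 5 pos by (intro mult_nonpos_nonneg; simp)+
    then show ?thesis using q assms(2) by simp
  qed
  then show ?thesis by (simp add: A_def Suc)
qed

lemma best_approximation:
  assumes "\<omega> \<notin> \<rat>" "1 \<le> q" "\<bar>real_of_int q * \<omega> - real_of_int p\<bar> < cf_prod \<omega> k"
  shows "cf_denom \<omega> k \<le> q"
  by (rule best_approximation_frac[OF assms(1,2), of "p - q * \<lfloor>\<omega>\<rfloor>"])
     (use assms(3) in \<open>simp add: frac_def algebra_simps\<close>)

section \<open>Small divisors\<close>

definition deg :: "nat \<times> nat \<Rightarrow> nat" where
  "deg \<alpha> = fst \<alpha> + snd \<alpha>"

text \<open>
  The linear form \<open>\<alpha> \<mapsto> \<langle>\<lambda>, \<alpha>\<rangle>\<close> with \<open>\<lambda> = (-1, \<omega>)\<close>. On unit vectors it gives the eigenvalues,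
  so that components of the vector field can be indexed by unit vectors and the small divisors are
  differences of values of one additive function.
\<close>

definition eigen :: "real \<Rightarrow> nat \<times> nat \<Rightarrow> real" where
  "eigen \<omega> \<alpha> = \<omega> * real (snd \<alpha>) - real (fst \<alpha>)"

definition units :: "(nat \<times> nat) set" where
  "units = {(1, 0), (0, 1)}"

definition divisor :: "real \<Rightarrow> nat \<times> nat \<Rightarrow> nat \<times> nat \<Rightarrow> real" where
  "divisor \<omega> \<alpha> e = eigen \<omega> \<alpha> - eigen \<omega> e"

lemma deg_add [simp]: "deg (\<alpha> + \<beta>) = deg \<alpha> + deg \<beta>"
  by (simp add: deg_def)

lemma deg_zero [simp]: "deg 0 = 0"
  by (simp add: deg_def)

lemma eigen_add: "eigen \<omega> (\<alpha> + \<beta>) = eigen \<omega> \<alpha> + eigen \<omega> \<beta>"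
  by (simp add: eigen_def algebra_simps)

lemma deg_unit: "e \<in> units \<Longrightarrow> deg e = 1"
  by (auto simp: units_def deg_def)

lemma divisor_nonzero:
  assumes "\<omega> \<notin> \<rat>" "2 \<le> deg \<alpha>" "e \<in> units"
  shows "divisor \<omega> \<alpha> e \<noteq> 0"
proof
  assume 0: "divisor \<omega> \<alpha> e = 0"
  let ?p = "int (fst \<alpha>) - int (fst e)" and ?q = "int (snd \<alpha>) - int (snd e)"
  have eq: "\<omega> * real_of_int ?q = real_of_int ?p"
    using 0 by (simp add: divisor_def eigen_def algebra_simps)
  have "?q = 0"
  proof (rule ccontr)
    assume "?q \<noteq> 0"
    then have "\<omega> = real_of_int ?p / real_of_int ?q" using eq by (simp add: field_simps)
    also have "\<dots> \<in> \<rat>" by (intro Rats_divide Rats_of_int)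
    finally show False using assms(1) by simp
  qed
  moreover have "?p = 0" using eq \<open>?q = 0\<close> by simp
  ultimately show False using assms(2,3) by (auto simp: units_def deg_def)
qed

text \<open>
  The divisor is \<open>q \<omega> - p\<close> with \<open>(p, q) = \<alpha> - e\<close>. As \<open>\<omega>\<close> is positive and \<open>p, q \<ge> -1\<close>, a divisor
  below \<open>1\<close> forces \<open>p \<ge> 0\<close> and \<open>q \<ge> 1\<close>, so that \<open>\<bar>\<alpha>\<bar> - 1 = p + q \<ge> q\<close> and \<open>q\<close> is a good
  denominator.
\<close>

lemma small_divisor_degree:
  assumes "\<omega> \<notin> \<rat>" "0 < \<omega>" "2 \<le> deg \<alpha>" "e \<in> units" "\<bar>divisor \<omega> \<alpha> e\<bar> < cf_prod \<omega> k"
  shows "cf_denom \<omega> k + 1 \<le> int (deg \<alpha>)"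
proof -
  let ?p = "int (fst \<alpha>) - int (fst e)" and ?q = "int (snd \<alpha>) - int (snd e)"
  have D: "divisor \<omega> \<alpha> e = real_of_int ?q * \<omega> - real_of_int ?p"
    by (simp add: divisor_def eigen_def algebra_simps)
  have lt1: "\<bar>divisor \<omega> \<alpha> e\<bar> < 1" using assms(5) cf_prod_le_1[OF assms(1), of k] by linarith
  have sum: "?p + ?q + 1 = int (deg \<alpha>)"
    using assms(4) by (auto simp: units_def deg_def)
  then have ge1: "?p + ?q \<ge> 1" using assms(3) by linarith
  have pq: "?p \<ge> -1" "?q \<ge> -1" using assms(4) by (auto simp: units_def)
  have q: "1 \<le> ?q"
  proof (rule ccontr)
    assume "\<not> 1 \<le> ?q"
    then have "real_of_int ?q \<le> 0" "1 \<le> real_of_int ?p" using ge1 by linarith+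
    then have "real_of_int ?q * \<omega> \<le> 0" using assms(2) by (intro mult_nonpos_nonneg) auto
    then show False using lt1 D \<open>1 \<le> real_of_int ?p\<close> by linarith
  qed
  have "0 \<le> ?p"
  proof (rule ccontr)
    assume "\<not> 0 \<le> ?p"
    then have "real_of_int ?p \<le> -1" by linarith
    moreover have "0 \<le> real_of_int ?q * \<omega>" using q assms(2) by (intro mult_nonneg_nonneg) auto
    ultimately show False using lt1 D by linarith
  qed
  moreover have "cf_denom \<omega> k \<le> ?q"
    by (rule best_approximation[OF assms(1) q, of ?p]) (use assms(5) D in simp)
  ultimately show ?thesis using sum by linarith
qed

section \<open>Counting small divisors\<close>

text \<open>
  Forests of \<open>k\<close> trees with total degree \<open>\<alpha>\<close>, and the list of the divisors \<open>(\<beta>, e)\<close> at their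
  inner nodes. They describe how a coefficient of a product of \<open>k\<close> components of \<open>\<Phi>\<close> arises when
  the recursion for the coefficients is unfolded: a node of degree \<open>\<beta>\<close> in component \<open>e\<close> is
  computed from a product of at least two components. Only the structure entering the count of small
  divisors is kept: leaves are lumped together, with any total degree that is at least their number,
  and the components at the roots are not recorded.
\<close>

inductive forest :: "nat \<times> nat \<Rightarrow> nat \<Rightarrow> ((nat \<times> nat) \<times> (nat \<times> nat)) list \<Rightarrow> bool" where
  leaves: "k \<le> deg \<alpha> \<Longrightarrow> forest \<alpha> k []"
| node: "forest \<alpha> k vs \<Longrightarrow> 2 \<le> k \<Longrightarrow> e \<in> units \<Longrightarrow> forest \<alpha> 1 ((\<alpha>, e) # vs)"
| union: "forest \<alpha> k vs \<Longrightarrow> forest \<alpha>' k' vs' \<Longrightarrow> forest (\<alpha> + \<alpha>') (k + k') (vs @ vs')"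

definition small_count :: "real \<Rightarrow> real \<Rightarrow> ((nat \<times> nat) \<times> (nat \<times> nat)) list \<Rightarrow> real" where
  "small_count \<omega> \<epsilon> vs = real (length (filter (\<lambda>(\<alpha>, e). \<bar>divisor \<omega> \<alpha> e\<bar> < \<epsilon>) vs))"

lemma forest_length: "forest \<alpha> k vs \<Longrightarrow> length vs + k \<le> deg \<alpha>"
  by (induction rule: forest.induct) auto

lemma forest_nodes:
  "forest \<alpha> k vs \<Longrightarrow> \<forall>(\<beta>, e) \<in> set vs. 2 \<le> deg \<beta> \<and> e \<in> units"
proof (induction rule: forest.induct)
  case (node \<alpha> k vs e)
  then show ?case using forest_length[OF node.hyps(1)] by auto
qed auto

text \<open>
  The vector \<open>\<rho>\<close> is what remains of the degree when each of the \<open>t\<close> topmost small nodes is replaced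
  by a leaf; as the linear form is additive, it changes by the sum of the \<open>t\<close> divisors removed. At a
  new small node, either \<open>t < s\<close>, and then \<open>\<rho>\<close> itself has divisor below \<open>\<eta>\<close>, hence degree above
  \<open>m\<close>, which pays for the node; or \<open>t \<ge> s\<close>, and then merging \<open>t\<close> topmost small nodes into one
  releases \<open>c (t - 1) \<ge> 1\<close>. The factor \<open>1 + c\<close> can thus be taken close to \<open>1\<close> for thresholds
  \<open>\<epsilon>\<close> far below \<open>\<eta>\<close>.
\<close>

lemma small_count_invariant:
  fixes s :: nat and \<epsilon> \<eta> m c :: real
  assumes s: "2 \<le> s" and eps: "0 < \<epsilon>" "s * \<epsilon> \<le> \<eta>" and m: "1 \<le> m"
    and gap: "\<And>\<alpha> e. 2 \<le> deg \<alpha> \<Longrightarrow> e \<in> units \<Longrightarrow> \<bar>divisor \<omega> \<alpha> e\<bar> < \<eta> \<Longrightarrow> m + 1 \<le> deg \<alpha>"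
    and c: "c = 1 / (real s - 1)"
    and F: "forest \<alpha> k vs"
  shows "\<exists>\<rho> t. k \<le> deg \<rho> \<and> \<bar>eigen \<omega> \<alpha> - eigen \<omega> \<rho>\<bar> \<le> real t * \<epsilon> \<and>
    small_count \<omega> \<epsilon> vs \<le> (1 + c) * (real (deg \<alpha>) - real (deg \<rho>)) / m - c * real t"
  using F
proof (induction rule: forest.induct)
  case (leaves k \<alpha>)
  then show ?case by (intro exI[of _ \<alpha>] exI[of _ 0]) (simp add: small_count_def)
next
  case (node \<alpha> k vs e)
  then obtain \<rho> t where IH: "k \<le> deg \<rho>" "\<bar>eigen \<omega> \<alpha> - eigen \<omega> \<rho>\<bar> \<le> real t * \<epsilon>"
    "small_count \<omega> \<epsilon> vs \<le> (1 + c) * (real (deg \<alpha>) - real (deg \<rho>)) / m - c * real t"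
    by blast
  have c0: "0 < c" "c * (real s - 1) = 1" using s by (simp_all add: c)
  show ?case
  proof (cases "\<bar>divisor \<omega> \<alpha> e\<bar> < \<epsilon>")
    case False
    then show ?thesis using IH node
      by (intro exI[of _ \<rho>] exI[of _ t]) (simp add: small_count_def)
  next
    case small: True
    \<comment> \<open>The node itself becomes the only topmost small node, and a leaf of degree 1 remains.\<close>
    have "small_count \<omega> \<epsilon> vs + 1 \<le> (1 + c) * (real (deg \<alpha>) - 1) / m - c"
    proof (cases "t + 1 \<le> s")
      case True
      have "\<bar>divisor \<omega> \<rho> e\<bar> < \<epsilon> + real t * \<epsilon>"
        using small IH(2) unfolding divisor_def by linarith
      also have "\<dots> = real (t + 1) * \<epsilon>" by (simp add: algebra_simps)
      also have "\<dots> \<le> real s * \<epsilon>" using True eps by (intro mult_right_mono) auto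
      also have "\<dots> \<le> \<eta>" by fact
      finally have "m + 1 \<le> deg \<rho>" using gap[of \<rho> e] IH(1) node by linarith
      then have "(1 + c) * (real (deg \<alpha>) - real (deg \<rho>)) / m
          \<le> (1 + c) * (real (deg \<alpha>) - 1 - m) / m"
        using c0 m by (intro divide_right_mono mult_left_mono) auto
      also have "\<dots> = (1 + c) * (real (deg \<alpha>) - 1) / m - (1 + c)"
        using m by (simp add: field_simps)
      finally have "small_count \<omega> \<epsilon> vs \<le> (1 + c) * (real (deg \<alpha>) - 1) / m - (1 + c) - c * real t"
        using IH(3) by linarith
      moreover have "0 \<le> c * real t" using c0 by simp
      ultimately show ?thesis by linarith
    next
      case False
      have "c * s \<le> c * real t" using False c0 by (intro mult_left_mono) auto
      then have "1 + c \<le> c * real t" using c0(2) by (simp add: algebra_simps)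
      moreover have "(1 + c) * (real (deg \<alpha>) - real (deg \<rho>)) / m \<le> (1 + c) * (real (deg \<alpha>) - 1) / m"
        using c0 m IH(1) node by (intro divide_right_mono mult_left_mono) auto
      ultimately show ?thesis using IH(3) by linarith
    qed
    then show ?thesis using small node deg_unit[OF \<open>e \<in> units\<close>]
      by (intro exI[of _ e] exI[of _ 1]) (auto simp: small_count_def divisor_def)
  qed
next
  case (union \<alpha> k vs \<alpha>' k' vs')
  then obtain \<rho> t \<rho>' t' where
    1: "k \<le> deg \<rho>" "\<bar>eigen \<omega> \<alpha> - eigen \<omega> \<rho>\<bar> \<le> real t * \<epsilon>"
    "small_count \<omega> \<epsilon> vs \<le> (1 + c) * (real (deg \<alpha>) - real (deg \<rho>)) / m - c * real t" and
    2: "k' \<le> deg \<rho>'" "\<bar>eigen \<omega> \<alpha>' - eigen \<omega> \<rho>'\<bar> \<le> real t' * \<epsilon>"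
    "small_count \<omega> \<epsilon> vs' \<le> (1 + c) * (real (deg \<alpha>') - real (deg \<rho>')) / m - c * real t'"
    by blast
  have "small_count \<omega> \<epsilon> (vs @ vs') = small_count \<omega> \<epsilon> vs + small_count \<omega> \<epsilon> vs'"
    by (simp add: small_count_def)
  also have "\<dots> \<le> ((1 + c) * (real (deg \<alpha>) - real (deg \<rho>)) / m - c * real t)
      + ((1 + c) * (real (deg \<alpha>') - real (deg \<rho>')) / m - c * real t')"
    using 1 2 by linarith
  also have "\<dots> = (1 + c) * (real (deg (\<alpha> + \<alpha>')) - real (deg (\<rho> + \<rho>'))) / m - c * real (t + t')"
    using m by (simp add: field_simps)
  finally show ?case using 1 2
    by (intro exI[of _ "\<rho> + \<rho>'"] exI[of _ "t + t'"]) (auto simp: eigen_add algebra_simps)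
qed

lemma small_count_le:
  assumes "\<omega> \<notin> \<rat>" "0 < \<omega>" "1 \<le> i" "forest \<alpha> k vs"
  shows "small_count \<omega> (cf_prod \<omega> l / 2 ^ i) vs
    \<le> (1 + 2 / 2 ^ i) * (real (deg \<alpha>) - real k) / cf_denom \<omega> l"
proof -
  define m where "m = real_of_int (cf_denom \<omega> l)"
  define c where "c = 1 / (real (2 ^ i) - 1)"
  have m: "1 \<le> m" using cf_denom_pos_mono[OF assms(1), of l] by (simp add: m_def)
  have "(2::nat) ^ 1 \<le> 2 ^ i" using assms(3) by (intro power_increasing) auto
  then have i: "(2::nat) \<le> 2 ^ i" by simp
  then have "real 2 \<le> real (2 ^ i)" by (simp only: of_nat_le_iff)
  then have i': "(2::real) \<le> 2 ^ i" by simp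
  have gap: "m + 1 \<le> deg \<alpha>" if "2 \<le> deg \<alpha>" "e \<in> units" "\<bar>divisor \<omega> \<alpha> e\<bar> < cf_prod \<omega> l" for \<alpha> e
    using small_divisor_degree[OF assms(1,2) that] by (simp add: m_def)
  have "\<exists>\<rho> t. k \<le> deg \<rho> \<and> \<bar>eigen \<omega> \<alpha> - eigen \<omega> \<rho>\<bar> \<le> real t * (cf_prod \<omega> l / 2 ^ i) \<and>
    small_count \<omega> (cf_prod \<omega> l / 2 ^ i) vs
      \<le> (1 + c) * (real (deg \<alpha>) - real (deg \<rho>)) / m - c * real t"
  proof (rule small_count_invariant[OF i _ _ m gap c_def assms(4)])
    show "0 < cf_prod \<omega> l / 2 ^ i" using cf_prod_pos[OF assms(1), of l] by simp
    show "real (2 ^ i) * (cf_prod \<omega> l / 2 ^ i) \<le> cf_prod \<omega> l" by simp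
  qed
  then obtain \<rho> t where *: "k \<le> deg \<rho>" "small_count \<omega> (cf_prod \<omega> l / 2 ^ i) vs
      \<le> (1 + c) * (real (deg \<alpha>) - real (deg \<rho>)) / m - c * real t"
    by blast
  have c0: "0 \<le> c" using i' by (simp add: c_def)
  have c2: "c \<le> 2 / 2 ^ i" using i' by (simp add: c_def field_simps)
  have k: "k \<le> deg \<alpha>" using forest_length[OF assms(4)] by simp
  have "(1 + c) * (real (deg \<alpha>) - real (deg \<rho>)) / m \<le> (1 + c) * (real (deg \<alpha>) - real k) / m"
    using c0 m * by (intro divide_right_mono mult_left_mono) auto
  also have "\<dots> \<le> (1 + 2 / 2 ^ i) * (real (deg \<alpha>) - real k) / m"
    using c2 m k by (intro divide_right_mono mult_right_mono) auto
  finally have "small_count \<omega> (cf_prod \<omega> l / 2 ^ i) vs + c * real t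
      \<le> (1 + 2 / 2 ^ i) * (real (deg \<alpha>) - real k) / m"
    using *(2) by linarith
  moreover have "0 \<le> c * real t" using c0 by simp
  ultimately show ?thesis by (simp only: m_def)
qed

section \<open>The product of the inverse divisors along a forest\<close>

text \<open>
  The number of dyadic thresholds needed to get from \<open>\<beta>\<^sub>l\<^sub>-\<^sub>1\<close> down to \<open>\<beta>\<^sub>l = x\<^sub>l \<beta>\<^sub>l\<^sub>-\<^sub>1\<close>.
\<close>

definition levels :: "real \<Rightarrow> nat \<Rightarrow> nat" where
  "levels \<omega> l = nat \<lceil>log 2 (1 / cf_rem \<omega> l)\<rceil>"

lemma levels_bounds:
  assumes "\<omega> \<notin> \<rat>"
  shows "- ln (cf_rem \<omega> l) \<le> ln 2 * levels \<omega> l" "ln 2 * levels \<omega> l \<le> - ln (cf_rem \<omega> l) + ln 2"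
proof -
  let ?x = "cf_rem \<omega> l"
  have x: "0 < ?x" "?x < 1" using cf_rem_bounds[OF assms] by auto
  have log: "ln 2 * log 2 (1 / ?x) = - ln ?x" using x by (simp add: log_def ln_div)
  have "0 \<le> log 2 (1 / ?x)" using x by simp
  then have "log 2 (1 / ?x) \<le> levels \<omega> l" "levels \<omega> l \<le> log 2 (1 / ?x) + 1"
    unfolding levels_def by linarith+
  then have "ln 2 * log 2 (1 / ?x) \<le> ln 2 * levels \<omega> l"
    "ln 2 * levels \<omega> l \<le> ln 2 * (log 2 (1 / ?x) + 1)"
    by (intro mult_left_mono; simp)+
  then show "- ln ?x \<le> ln 2 * levels \<omega> l" "ln 2 * levels \<omega> l \<le> - ln ?x + ln 2"
    using log by (simp_all add: algebra_simps)
qed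

text \<open>
  The left side is the part of \<open>log (1 / 2d)\<close> that lies above the scale \<open>\<beta>\<^sub>L\<^sub>-\<^sub>1\<close>. Passing one
  dyadic threshold accounts for \<open>log 2\<close> of it; the factor \<open>2\<close> is lost because the thresholds
  start at \<open>\<beta>\<^sub>l\<^sub>-\<^sub>1 / 2\<close>, the largest for which the counting lemma applies.
\<close>

lemma ln_divisor_le_levels:
  assumes irr: "\<omega> \<notin> \<rat>" and d: "0 < d"
  shows "min (- ln (cf_prod \<omega> L)) (- ln (2 * d))
    \<le> (\<Sum>l<L. ln 2 * real (card {i \<in> {1..levels \<omega> l}. d < cf_prod \<omega> l / 2 ^ i}))"
proof (induction L)
  case 0
  show ?case by simp
next
  case (Suc l)
  let ?S = "{i \<in> {1..levels \<omega> l}. d < cf_prod \<omega> l / 2 ^ i}"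
  define b where "b = cf_prod \<omega> l"
  define y where "y = - ln (2 * d)"
  have b: "0 < b" using cf_prod_pos[OF irr] by (simp add: b_def)
  have ln_Suc: "- ln (cf_prod \<omega> (Suc l)) = - ln b + - ln (cf_rem \<omega> l)"
    using b cf_rem_bounds[OF irr, of l] by (simp add: cf_prod_Suc b_def ln_mult)
  have nonneg: "0 \<le> ln 2 * real (card ?S)" by simp
  have "min (- ln b + - ln (cf_rem \<omega> l)) y \<le> min (- ln b) y + ln 2 * card ?S"
  proof (cases "card ?S < levels \<omega> l")
    case False
    then have "ln 2 * levels \<omega> l \<le> ln 2 * card ?S" by (intro mult_left_mono) auto
    then have "- ln (cf_rem \<omega> l) \<le> ln 2 * card ?S"
      using levels_bounds(1)[OF irr, of l] by linarith
    then show ?thesis using nonneg by linarith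
  next
    case True
    \<comment> \<open>The set is an initial segment, so its size names the first threshold not passed.\<close>
    have ge: "b / 2 ^ Suc (card ?S) \<le> d"
    proof (rule ccontr)
      assume "\<not> b / 2 ^ Suc (card ?S) \<le> d"
      then have lt: "d < b / 2 ^ Suc (card ?S)" by simp
      have "{1..Suc (card ?S)} \<subseteq> ?S"
      proof
        fix i assume i: "i \<in> {1..Suc (card ?S)}"
        have "b / 2 ^ Suc (card ?S) \<le> b / 2 ^ i"
          using i b by (intro divide_left_mono power_increasing) auto
        then show "i \<in> ?S" using i lt True by (simp add: b_def)
      qed
      then have "card {1..Suc (card ?S)} \<le> card ?S" by (intro card_mono) auto
      then show False by simp
    qed
    have "b / 2 ^ card ?S \<le> 2 * d" using ge by (simp add: field_simps)
    then have "ln (b / 2 ^ card ?S) \<le> ln (2 * d)" using b d by (subst ln_le_cancel_iff) auto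
    then have "y \<le> - ln b + ln 2 * card ?S"
      using b by (simp add: y_def ln_div ln_realpow mult.commute)
    then show ?thesis using nonneg by linarith
  qed
  then show ?case using Suc unfolding ln_Suc by (simp add: b_def y_def)
qed

definition cost :: "real \<Rightarrow> ((nat \<times> nat) \<times> (nat \<times> nat)) list \<Rightarrow> real" where
  "cost \<omega> vs = (\<Sum>(\<alpha>, e) \<leftarrow> vs. - ln \<bar>divisor \<omega> \<alpha> e\<bar>)"

lemma cost_le_counts:
  assumes irr: "\<omega> \<notin> \<rat>"
    and L: "\<forall>(\<alpha>, e) \<in> set vs. 0 < \<bar>divisor \<omega> \<alpha> e\<bar> \<and> cf_prod \<omega> L \<le> 2 * \<bar>divisor \<omega> \<alpha> e\<bar>"
  shows "cost \<omega> vs \<le> ln 2 * length vs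
    + (\<Sum>l<L. ln 2 * (\<Sum>i = 1..levels \<omega> l. small_count \<omega> (cf_prod \<omega> l / 2 ^ i) vs))"
  using L
proof (induction vs)
  case Nil
  show ?case by (simp add: cost_def small_count_def)
next
  case (Cons v vs)
  obtain \<alpha> e where v: "v = (\<alpha>, e)" by (cases v)
  define d where "d = \<bar>divisor \<omega> \<alpha> e\<bar>"
  have d: "0 < d" "cf_prod \<omega> L \<le> 2 * d" using Cons.prems by (auto simp: v d_def)
  have "ln (cf_prod \<omega> L) \<le> ln (2 * d)"
    using d cf_prod_pos[OF irr, of L] by (subst ln_le_cancel_iff) auto
  then have "- ln d \<le> ln 2
      + (\<Sum>l<L. ln 2 * real (card {i \<in> {1..levels \<omega> l}. d < cf_prod \<omega> l / 2 ^ i}))"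
    using ln_divisor_le_levels[OF irr d(1), of L] d(1) by (simp add: ln_mult)
  moreover have IH: "cost \<omega> vs \<le> ln 2 * length vs
    + (\<Sum>l<L. ln 2 * (\<Sum>i = 1..levels \<omega> l. small_count \<omega> (cf_prod \<omega> l / 2 ^ i) vs))"
    using Cons.IH Cons.prems by (meson list.set_intros(2))
  moreover have "(\<Sum>l<L. ln 2 * real (card {i \<in> {1..levels \<omega> l}. d < cf_prod \<omega> l / 2 ^ i}))
      + (\<Sum>l<L. ln 2 * (\<Sum>i = 1..levels \<omega> l. small_count \<omega> (cf_prod \<omega> l / 2 ^ i) vs))
    = (\<Sum>l<L. ln 2 * (\<Sum>i = 1..levels \<omega> l. small_count \<omega> (cf_prod \<omega> l / 2 ^ i) (v # vs)))"
    unfolding sum.distrib[symmetric] distrib_left[symmetric]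
  proof (rule sum.cong[OF refl], rule arg_cong[where f = "\<lambda>x. ln 2 * x"])
    fix l
    have "real (card {i \<in> {1..levels \<omega> l}. d < cf_prod \<omega> l / 2 ^ i})
      = (\<Sum>i = 1..levels \<omega> l. if d < cf_prod \<omega> l / 2 ^ i then 1 else 0)"
      using sum.inter_filter[of "{1..levels \<omega> l}" "\<lambda>i. 1::real" "\<lambda>i. d < cf_prod \<omega> l / 2 ^ i"]
      by simp
    then have "real (card {i \<in> {1..levels \<omega> l}. d < cf_prod \<omega> l / 2 ^ i})
        + (\<Sum>i = 1..levels \<omega> l. small_count \<omega> (cf_prod \<omega> l / 2 ^ i) vs)
      = (\<Sum>i = 1..levels \<omega> l. (if d < cf_prod \<omega> l / 2 ^ i then 1 else 0)
        + small_count \<omega> (cf_prod \<omega> l / 2 ^ i) vs)"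
      by (simp only: sum.distrib)
    also have "\<dots> = (\<Sum>i = 1..levels \<omega> l. small_count \<omega> (cf_prod \<omega> l / 2 ^ i) (v # vs))"
      by (rule sum.cong) (simp_all add: small_count_def v d_def)
    finally show "real (card {i \<in> {1..levels \<omega> l}. d < cf_prod \<omega> l / 2 ^ i})
        + (\<Sum>i = 1..levels \<omega> l. small_count \<omega> (cf_prod \<omega> l / 2 ^ i) vs)
      = (\<Sum>i = 1..levels \<omega> l. small_count \<omega> (cf_prod \<omega> l / 2 ^ i) (v # vs))" .
  qed
  moreover have "cost \<omega> (v # vs) = - ln d + cost \<omega> vs" by (simp add: cost_def v d_def)
  moreover have "ln 2 * real (length (v # vs)) = ln 2 + ln 2 * real (length vs)"
    by (simp add: algebra_simps)
  ultimately show ?case by linarith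
qed

lemma sum_levels_le: "(\<Sum>i = 1..n. 1 + 2 / 2 ^ i) \<le> real n + (2::real)"
proof -
  have "(\<Sum>i = 1..n. 1 + 2 / 2 ^ i) = real n + 2 - 2 / (2::real) ^ n"
  proof (induction n)
    case (Suc n)
    have "2 - 2 / 2 ^ n + 2 / 2 ^ Suc n = 2 - 2 / (2::real) ^ Suc n" by (simp add: field_simps)
    then show ?case using Suc by simp
  qed simp
  then show ?thesis by simp
qed

lemma cf_level_cost_le:
  assumes "\<omega> \<notin> \<rat>"
  shows "ln 2 * (real (levels \<omega> l) + 2) / cf_denom \<omega> l
    \<le> - (cf_prod \<omega> l * ln (cf_rem \<omega> l)) + (1 + 6 * ln 2) * cf_prod \<omega> l"
proof -
  define x where "x = cf_rem \<omega> l"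
  define b where "b = cf_prod \<omega> l"
  have x: "0 < x" "x < 1" using cf_rem_bounds[OF assms] by (auto simp: x_def)
  have b: "0 < b" using cf_prod_pos[OF assms] by (simp add: b_def)
  have "- ln x = ln (1 / x)" using x by (simp add: ln_div)
  also have "\<dots> \<le> 1 / x - 1" using x by (intro ln_le_minus_one) auto
  finally have "x * - ln x \<le> x * (1 / x - 1)" using x by (intro mult_left_mono) auto
  also have "\<dots> \<le> 1" using x by (simp add: field_simps)
  finally have xln: "x * - ln x \<le> 1" .
  have "ln x < 0" "0 < ln (2::real)" using x by simp_all
  then have num: "0 \<le> - ln x + 3 * ln 2" by linarith
  have "ln 2 * (real (levels \<omega> l) + 2) / cf_denom \<omega> l \<le> (- ln x + 3 * ln 2) / cf_denom \<omega> l"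
    using levels_bounds(2)[OF assms, of l] cf_denom_pos_mono[OF assms, of l]
    by (intro divide_right_mono) (auto simp: x_def algebra_simps)
  also have "\<dots> = (- ln x + 3 * ln 2) * (1 / cf_denom \<omega> l)" by simp
  also have "\<dots> \<le> (- ln x + 3 * ln 2) * (b + b * x)"
    using inverse_cf_denom_le[OF assms, of l] num
    by (intro mult_left_mono) (auto simp: b_def x_def cf_prod_Suc)
  also have "\<dots> = - (b * ln x) + b * (x * - ln x) + 3 * ln 2 * b + 3 * ln 2 * b * x"
    by (simp add: algebra_simps)
  also have "\<dots> \<le> - (b * ln x) + b * 1 + 3 * ln 2 * b + 3 * ln 2 * b * 1"
    using xln x b by (intro add_mono mult_left_mono) auto
  finally show ?thesis by (simp add: b_def x_def algebra_simps)
qed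

text \<open>
  The heart of the estimate. The bound \<open>B\<close> enters with exactly the factor \<open>\<bar>\<alpha>\<bar> - k\<close>, since at
  each scale \<open>l\<close> the thresholds contribute \<open>(\<bar>\<alpha>\<bar> - k) (log (1 / x\<^sub>l) + O(1)) / q\<^sub>l\<close>: the surplus factors
  \<open>1 + 2 / 2\<^sup>i\<close> in the counts add up to a bounded number of additional thresholds.
\<close>

lemma forest_cost_le:
  assumes irr: "\<omega> \<notin> \<rat>" and pos: "0 < \<omega>"
    and B: "\<And>L. (\<Sum>l<L. - (cf_prod \<omega> l * ln (cf_rem \<omega> l))) \<le> B"
    and F: "forest \<alpha> k vs"
  shows "cost \<omega> vs \<le> (real (deg \<alpha>) - real k) * (B + 4 + 25 * ln 2)"
proof -
  let ?N = "real (deg \<alpha>) - real k"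
  have N: "0 \<le> ?N" "length vs \<le> ?N" using forest_length[OF F] by linarith+
  have nz: "\<forall>(\<beta>, e) \<in> set vs. 0 < \<bar>divisor \<omega> \<beta> e\<bar>"
    using forest_nodes[OF F] divisor_nonzero[OF irr] by fastforce
  have "\<forall>v \<in> set vs. \<forall>\<^sub>F L in sequentially. cf_prod \<omega> L < 2 * \<bar>divisor \<omega> (fst v) (snd v)\<bar>"
    using nz order_tendstoD(2)[OF cf_prod_tendsto_0[OF irr]] by fastforce
  then have "\<forall>\<^sub>F L in sequentially. \<forall>v \<in> set vs. cf_prod \<omega> L < 2 * \<bar>divisor \<omega> (fst v) (snd v)\<bar>"
    by (intro eventually_ball_finite) auto
  then obtain L where L: "\<forall>v \<in> set vs. cf_prod \<omega> L < 2 * \<bar>divisor \<omega> (fst v) (snd v)\<bar>"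
    using eventually_happens'[OF sequentially_bot] by blast
  have "cost \<omega> vs \<le> ln 2 * length vs
    + (\<Sum>l<L. ln 2 * (\<Sum>i = 1..levels \<omega> l. small_count \<omega> (cf_prod \<omega> l / 2 ^ i) vs))"
  proof (rule cost_le_counts[OF irr], rule ballI, clarify, intro conjI)
    fix a b c d assume v: "((a, b), (c, d)) \<in> set vs"
    show "0 < \<bar>divisor \<omega> (a, b) (c, d)\<bar>" using nz v by blast
    show "cf_prod \<omega> L \<le> 2 * \<bar>divisor \<omega> (a, b) (c, d)\<bar>" using bspec[OF L v] by simp
  qed
  also have "\<dots> \<le> ln 2 * ?N + (\<Sum>l<L. ?N * (- (cf_prod \<omega> l * ln (cf_rem \<omega> l))
      + (1 + 6 * ln 2) * cf_prod \<omega> l))"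
  proof (intro add_mono sum_mono)
    show "ln 2 * length vs \<le> ln 2 * ?N" using N by (intro mult_left_mono) auto
    fix l
    let ?q = "real_of_int (cf_denom \<omega> l)"
    have q: "1 \<le> ?q" using cf_denom_pos_mono[OF irr, of l] by simp
    have "(\<Sum>i = 1..levels \<omega> l. small_count \<omega> (cf_prod \<omega> l / 2 ^ i) vs)
        \<le> (\<Sum>i = 1..levels \<omega> l. (1 + 2 / 2 ^ i) * (?N / ?q))"
      using small_count_le[OF irr pos _ F] by (intro sum_mono) (simp add: times_divide_eq_right)
    also have "\<dots> = (\<Sum>i = 1..levels \<omega> l. 1 + 2 / 2 ^ i) * (?N / ?q)"
      by (rule sum_distrib_right[symmetric])
    also have "\<dots> \<le> (real (levels \<omega> l) + 2) * (?N / ?q)"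
      using N q by (intro mult_right_mono[OF sum_levels_le]) auto
    finally have "ln 2 * (\<Sum>i = 1..levels \<omega> l. small_count \<omega> (cf_prod \<omega> l / 2 ^ i) vs)
        \<le> ln 2 * ((real (levels \<omega> l) + 2) * (?N / ?q))" by (intro mult_left_mono) auto
    also have "\<dots> = ?N * (ln 2 * (real (levels \<omega> l) + 2) / ?q)" by simp
    also have "\<dots> \<le> ?N * (- (cf_prod \<omega> l * ln (cf_rem \<omega> l)) + (1 + 6 * ln 2) * cf_prod \<omega> l)"
      using cf_level_cost_le[OF irr, of l] N by (intro mult_left_mono) auto
    finally show "ln 2 * (\<Sum>i = 1..levels \<omega> l. small_count \<omega> (cf_prod \<omega> l / 2 ^ i) vs)
      \<le> ?N * (- (cf_prod \<omega> l * ln (cf_rem \<omega> l)) + (1 + 6 * ln 2) * cf_prod \<omega> l)" .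
  qed
  also have "\<dots> = ?N * (ln 2 + (\<Sum>l<L. - (cf_prod \<omega> l * ln (cf_rem \<omega> l)))
      + (1 + 6 * ln 2) * (\<Sum>l<L. cf_prod \<omega> l))"
    unfolding sum_distrib_left[symmetric] sum.distrib by (simp add: algebra_simps)
  also have "\<dots> \<le> ?N * (ln 2 + B + (1 + 6 * ln 2) * 4)"
    using N B[of L] sum_cf_prod_le[OF irr, of L] by (intro mult_left_mono add_mono) auto
  finally show ?thesis by (simp add: algebra_simps)
qed

section \<open>Weights that absorb the small divisors\<close>

text \<open>
  The logarithm of the largest product of inverse divisors along a forest. Dividing the coefficients
  by its exponential removes the small divisors from the recursion.
\<close>

definition weight :: "real \<Rightarrow> nat \<times> nat \<Rightarrow> nat \<Rightarrow> real" where
  "weight \<omega> \<alpha> k = Sup {cost \<omega> vs | vs. forest \<alpha> k vs}"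

locale bruno_bounded =
  fixes \<omega> B :: real
  assumes irr: "\<omega> \<notin> \<rat>" and pos: "0 < \<omega>"
    and B: "(\<Sum>l<L. - (cf_prod \<omega> l * ln (cf_rem \<omega> l))) \<le> B"
begin

definition rate :: real where
  "rate = B + 4 + 25 * ln 2"

lemma cost_le_weight: "forest \<alpha> k vs \<Longrightarrow> cost \<omega> vs \<le> weight \<omega> \<alpha> k"
  unfolding weight_def
  by (intro cSup_upper bdd_aboveI[where M = "(real (deg \<alpha>) - real k) * (B + 4 + 25 * ln 2)"])
     (auto intro: forest_cost_le[OF irr pos B])

lemma weight_le:
  assumes "k \<le> deg \<alpha>" and "\<And>vs. forest \<alpha> k vs \<Longrightarrow> cost \<omega> vs \<le> z"
  shows "weight \<omega> \<alpha> k \<le> z"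
  unfolding weight_def using assms by (intro cSup_least) (auto intro: leaves)

lemma weight_le_rate: "k \<le> deg \<alpha> \<Longrightarrow> weight \<omega> \<alpha> k \<le> (real (deg \<alpha>) - real k) * rate"
  unfolding rate_def by (intro weight_le forest_cost_le[OF irr pos B])

lemma weight_nonneg: "k \<le> deg \<alpha> \<Longrightarrow> 0 \<le> weight \<omega> \<alpha> k"
  using cost_le_weight[OF leaves] by (simp add: cost_def)

lemma weight_superadditive:
  assumes "k \<le> deg \<alpha>" "k' \<le> deg \<alpha>'"
  shows "weight \<omega> \<alpha> k + weight \<omega> \<alpha>' k' \<le> weight \<omega> (\<alpha> + \<alpha>') (k + k')"
proof -
  have sum: "cost \<omega> vs + cost \<omega> vs' \<le> weight \<omega> (\<alpha> + \<alpha>') (k + k')"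
    if "forest \<alpha> k vs" "forest \<alpha>' k' vs'" for vs vs'
    using cost_le_weight[OF union[OF that]] by (simp add: cost_def)
  have "cost \<omega> vs' \<le> weight \<omega> (\<alpha> + \<alpha>') (k + k') - cost \<omega> vs"
    if "forest \<alpha> k vs" "forest \<alpha>' k' vs'" for vs vs'
    using sum[OF that] by linarith
  then have "weight \<omega> \<alpha>' k' \<le> weight \<omega> (\<alpha> + \<alpha>') (k + k') - cost \<omega> vs" if "forest \<alpha> k vs" for vs
    using that assms(2) by (intro weight_le) auto
  then have "cost \<omega> vs \<le> weight \<omega> (\<alpha> + \<alpha>') (k + k') - weight \<omega> \<alpha>' k'" if "forest \<alpha> k vs" for vs
    using that by fastforce
  then have "weight \<omega> \<alpha> k \<le> weight \<omega> (\<alpha> + \<alpha>') (k + k') - weight \<omega> \<alpha>' k'"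
    using assms(1) by (intro weight_le) auto
  then show ?thesis by simp
qed

lemma weight_node:
  assumes "2 \<le> k" "k \<le> deg \<alpha>" "e \<in> units"
  shows "weight \<omega> \<alpha> k - ln \<bar>divisor \<omega> \<alpha> e\<bar> \<le> weight \<omega> \<alpha> 1"
proof -
  have "weight \<omega> \<alpha> k \<le> weight \<omega> \<alpha> 1 + ln \<bar>divisor \<omega> \<alpha> e\<bar>"
  proof (rule weight_le[OF assms(2)])
    fix vs assume "forest \<alpha> k vs"
    then show "cost \<omega> vs \<le> weight \<omega> \<alpha> 1 + ln \<bar>divisor \<omega> \<alpha> e\<bar>"
      using cost_le_weight[OF node[OF _ assms(1,3)]] by (fastforce simp: cost_def)
  qed
  then show ?thesis by simp
qed

end

section \<open>Formal power series in two variables\<close>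

definition coeff_at :: "fps2 \<Rightarrow> nat \<times> nat \<Rightarrow> complex" where
  "coeff_at H \<alpha> = coeff2 H (fst \<alpha>) (snd \<alpha>)"

definition below :: "nat \<times> nat \<Rightarrow> (nat \<times> nat) set" where
  "below \<alpha> = {..fst \<alpha>} \<times> {..snd \<alpha>}"

text \<open>
  A map \<open>\<Phi>\<close> of \<open>\<complex>\<^sup>2\<close> is a family of series indexed by the unit vectors, so that \<open>\<Phi>\<close> is indexed in the
  same way as its linear part; \<open>power_product \<Phi> b\<close> is \<open>\<Phi>\<^sup>b\<close> in multi-index notation.
\<close>

definition power_product :: "(nat \<times> nat \<Rightarrow> fps2) \<Rightarrow> nat \<times> nat \<Rightarrow> fps2" where
  "power_product \<Phi> b = \<Phi> (1, 0) ^ fst b * \<Phi> (0, 1) ^ snd b"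

lemma fps2_eqI: "(\<And>\<alpha>. coeff_at H \<alpha> = coeff_at H' \<alpha>) \<Longrightarrow> H = H'"
  by (intro fps_ext) (metis coeff_at_def coeff2_def fst_conv snd_conv)

lemma coeff_at_add: "coeff_at (H + H') \<alpha> = coeff_at H \<alpha> + coeff_at H' \<alpha>"
  by (simp add: coeff_at_def coeff2_def)

lemma finite_deg_less [simp]: "finite {\<alpha>. deg \<alpha> < n}"
  by (rule finite_subset[of _ "{..<n} \<times> {..<n}"]) (auto simp: deg_def)

lemma finite_deg_le [simp]: "finite {\<alpha>. deg \<alpha> \<le> n}"
  using finite_deg_less[of "Suc n"] by (simp add: less_Suc_eq_le)

lemma finite_below [simp]: "finite (below \<alpha>)"
  by (simp add: below_def)

lemma below_diff:
  assumes "\<beta> \<in> below \<alpha>"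
  shows "\<beta> + (\<alpha> - \<beta>) = \<alpha>" "deg \<beta> + deg (\<alpha> - \<beta>) = deg \<alpha>"
proof -
  show "\<beta> + (\<alpha> - \<beta>) = \<alpha>" using assms by (cases \<alpha>; cases \<beta>) (auto simp: below_def)
  then show "deg \<beta> + deg (\<alpha> - \<beta>) = deg \<alpha>" by (metis deg_add)
qed

lemma deg_0_iff [simp]: "deg \<alpha> = 0 \<longleftrightarrow> \<alpha> = 0"
  by (cases \<alpha>) (auto simp: deg_def zero_prod_def)

lemma deg_1_iff: "deg \<alpha> = 1 \<longleftrightarrow> \<alpha> \<in> units"
  by (cases \<alpha>) (auto simp: deg_def units_def)

lemma coeff_at_mult: "coeff_at (H * H') \<alpha> = (\<Sum>\<beta>\<in>below \<alpha>. coeff_at H \<beta> * coeff_at H' (\<alpha> - \<beta>))"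
  by (simp add: coeff_at_def coeff2_def fps_mult_nth fps_sum_nth below_def sum.cartesian_product
      atLeast0AtMost case_prod_beta)

lemma coeff_at_1: "coeff_at 1 \<alpha> = (if \<alpha> = 0 then 1 else 0)"
  by (cases \<alpha>) (auto simp: coeff_at_def coeff2_def zero_prod_def)

lemma units_induct [case_names zero add]:
  assumes "P 0" and "\<And>b e. P b \<Longrightarrow> e \<in> units \<Longrightarrow> P (b + e)"
  shows "P b"
proof -
  have "P (m, 0)" for m
  proof (induction m)
    case 0
    then show ?case using assms(1) by (simp add: zero_prod_def)
  next
    case (Suc m)
    then show ?case using assms(2)[of "(m, 0)" "(1, 0)"] by (simp add: units_def)
  qed
  then have "P (m, n)" for m n
  proof (induction n)
    case (Suc n)
    then show ?case using assms(2)[of "(m, n)" "(0, 1)"] by (simp add: units_def)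
  qed
  then show ?thesis by (cases b) auto
qed

lemma power_product_0 [simp]: "power_product \<Phi> 0 = 1"
  by (simp add: power_product_def)

lemma power_product_add_unit: "e \<in> units \<Longrightarrow> power_product \<Phi> (b + e) = power_product \<Phi> b * \<Phi> e"
  by (auto simp: power_product_def units_def)

lemma coeff_at_power_product_eq_0:
  assumes "\<And>e. e \<in> units \<Longrightarrow> coeff_at (\<Phi> e) 0 = 0" and "deg \<alpha> < deg b"
  shows "coeff_at (power_product \<Phi> b) \<alpha> = 0"
  using assms(2)
proof (induction b arbitrary: \<alpha> rule: units_induct)
  case zero
  then show ?case by (simp add: deg_def)
next
  case (add b e)
  have "coeff_at (power_product \<Phi> b) \<beta> * coeff_at (\<Phi> e) (\<alpha> - \<beta>) = 0" if "\<beta> \<in> below \<alpha>" for \<beta>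
  proof (cases "deg \<beta> < deg b")
    case True
    then show ?thesis using add.IH by simp
  next
    case False
    then have "deg (\<alpha> - \<beta>) = 0"
      using add.prems below_diff(2)[OF that] deg_unit[OF add.hyps] unfolding deg_add by linarith
    then show ?thesis using assms(1) add.hyps by simp
  qed
  then show ?case unfolding power_product_add_unit[OF add.hyps] coeff_at_mult by (intro sum.neutral) blast
qed

text \<open>
  Each factor has no constant term, so in a product of \<open>\<bar>b\<bar>\<close> factors a coefficient of degree below
  \<open>n + \<bar>b\<bar>\<close> involves only coefficients of degree at most \<open>n\<close> of each. For \<open>\<bar>b\<bar> \<ge> 2\<close> this makes
  the recursion for the linearization well-founded.
\<close>

lemma coeff_at_power_product_cong:
  assumes "\<And>e. e \<in> units \<Longrightarrow> coeff_at (\<Phi> e) 0 = 0" "\<And>e. e \<in> units \<Longrightarrow> coeff_at (\<Psi> e) 0 = 0"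
    and "\<And>e \<alpha>. e \<in> units \<Longrightarrow> deg \<alpha> \<le> n \<Longrightarrow> coeff_at (\<Phi> e) \<alpha> = coeff_at (\<Psi> e) \<alpha>"
    and "deg \<alpha> < n + deg b"
  shows "coeff_at (power_product \<Phi> b) \<alpha> = coeff_at (power_product \<Psi> b) \<alpha>"
  using assms(4)
proof (induction b arbitrary: \<alpha> rule: units_induct)
  case zero
  then show ?case by simp
next
  case (add b e)
  have "coeff_at (power_product \<Phi> b) \<beta> * coeff_at (\<Phi> e) (\<alpha> - \<beta>) = coeff_at (power_product \<Psi> b) \<beta> * coeff_at (\<Psi> e) (\<alpha> - \<beta>)"
    if "\<beta> \<in> below \<alpha>" for \<beta>
  proof -
    have d: "deg \<beta> + deg (\<alpha> - \<beta>) < n + deg b + 1"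
      using add.prems add.hyps below_diff(2)[OF that] deg_unit[of e] by simp
    consider "deg \<beta> < deg b" | "\<alpha> - \<beta> = 0" | "deg b \<le> deg \<beta>" "1 \<le> deg (\<alpha> - \<beta>)"
      by (metis deg_0_iff less_one not_le)
    then show ?thesis
    proof cases
      case 1
      then show ?thesis using coeff_at_power_product_eq_0 assms(1,2) by simp
    next
      case 2
      then show ?thesis using assms(1,2) add.hyps by simp
    next
      case 3
      then have "deg \<beta> < n + deg b" "deg (\<alpha> - \<beta>) \<le> n" using d by linarith+
      then show ?thesis using add.IH assms(3) add.hyps by simp
    qed
  qed
  then show ?case unfolding power_product_add_unit[OF add.hyps] coeff_at_mult by (intro sum.cong) blast+
qed

text \<open>
  The same degree count for sums: \<open>F\<close> starts in degree \<open>k\<close> and \<open>G\<close> in degree \<open>1\<close>, so that the terms of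
  their product up to degree \<open>n + k\<close> need \<open>G\<close> only up to degree \<open>n\<close>.
\<close>

lemma convolution_sum_le:
  fixes F G :: "nat \<times> nat \<Rightarrow> real"
  assumes nonneg: "\<And>\<alpha>. 0 \<le> F \<alpha>" "\<And>\<alpha>. 0 \<le> G \<alpha>"
    and vanish: "\<And>\<alpha>. deg \<alpha> < k \<Longrightarrow> F \<alpha> = 0" "G 0 = 0"
  shows "(\<Sum>\<alpha> | deg \<alpha> < n + k + 1. \<Sum>\<beta>\<in>below \<alpha>. F \<beta> * G (\<alpha> - \<beta>))
    \<le> (\<Sum>\<alpha> | deg \<alpha> < n + k. F \<alpha>) * (\<Sum>\<alpha> | deg \<alpha> \<le> n. G \<alpha>)"
proof -
  let ?P = "Sigma {\<alpha>. deg \<alpha> < n + k + 1} below"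
  let ?f = "\<lambda>(\<alpha>, \<beta>). (\<beta>, \<alpha> - \<beta>)"
  let ?g = "\<lambda>(\<beta>, \<gamma>). F \<beta> * G \<gamma>"
  let ?Q = "{\<alpha>. deg \<alpha> < n + k} \<times> {\<alpha>. deg \<alpha> \<le> n}"
  have inj: "inj_on ?f ?P"
    by (auto simp: inj_on_def below_def)
  have fin: "finite (?f ` ?P)" by (intro finite_imageI finite_SigmaI) auto
  have "(\<Sum>\<alpha> | deg \<alpha> < n + k + 1. \<Sum>\<beta>\<in>below \<alpha>. F \<beta> * G (\<alpha> - \<beta>)) = (\<Sum>x\<in>?P. ?g (?f x))"
    by (subst sum.Sigma) (auto simp: case_prod_beta)
  also have "\<dots> = (\<Sum>x\<in>?f ` ?P. ?g x)"
    using sum.reindex[OF inj, of ?g] by (simp add: o_def)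
  also have "\<dots> = (\<Sum>x\<in>?f ` ?P \<inter> ?Q. ?g x)"
  proof (rule sum.mono_neutral_right[OF fin], simp, rule ballI)
    fix x assume x: "x \<in> ?f ` ?P - ?f ` ?P \<inter> ?Q"
    then obtain \<alpha> \<beta> where ab: "deg \<alpha> < n + k + 1" "\<beta> \<in> below \<alpha>" "x = (\<beta>, \<alpha> - \<beta>)" by auto
    then have "\<not> (deg \<beta> < n + k \<and> deg (\<alpha> - \<beta>) \<le> n)" using x by auto
    then have "deg \<beta> < k \<or> deg (\<alpha> - \<beta>) = 0" using ab(1) below_diff(2)[OF ab(2)] by linarith
    then have "deg \<beta> < k \<or> \<alpha> - \<beta> = 0" by (simp only: deg_0_iff)
    then show "?g x = 0" using vanish(1)[of \<beta>] vanish(2) ab(3) by auto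
  qed
  also have "\<dots> \<le> (\<Sum>x\<in>?Q. ?g x)"
    by (rule sum_mono2) (use nonneg in auto)
  also have "\<dots> = (\<Sum>\<alpha> | deg \<alpha> < n + k. F \<alpha>) * (\<Sum>\<alpha> | deg \<alpha> \<le> n. G \<alpha>)"
    by (simp add: sum_product sum.cartesian_product)
  finally show ?thesis .
qed

section \<open>The linearization equation\<close>

text \<open>
  The conjugacy equation \<open>D\<Phi>(w) A w = f(\<Phi>(w))\<close> coefficientwise, after the linear part of \<open>f\<close> has
  been moved to the left side.
\<close>

definition linearizes :: "real \<Rightarrow> (nat \<times> nat \<Rightarrow> fps2) \<Rightarrow> (nat \<times> nat \<Rightarrow> fps2) \<Rightarrow> bool" where
  "linearizes \<omega> f \<Phi> \<longleftrightarrow> (\<forall>e\<in>units. \<forall>\<alpha>.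
     (deg \<alpha> \<le> 1 \<longrightarrow> coeff_at (\<Phi> e) \<alpha> = (if \<alpha> = e then 1 else 0)) \<and>
     (2 \<le> deg \<alpha> \<longrightarrow> divisor \<omega> \<alpha> e * coeff_at (\<Phi> e) \<alpha>
        = (\<Sum>b | 2 \<le> deg b \<and> deg b \<le> deg \<alpha>. coeff_at (f e) b * coeff_at (power_product \<Phi> b) \<alpha>)))"

lemma linearizes_low:
  "linearizes \<omega> f \<Phi> \<Longrightarrow> e \<in> units \<Longrightarrow> deg \<alpha> \<le> 1 \<Longrightarrow> coeff_at (\<Phi> e) \<alpha> = (if \<alpha> = e then 1 else 0)"
  unfolding linearizes_def by blast

lemma linearizes_eq:
  "linearizes \<omega> f \<Phi> \<Longrightarrow> e \<in> units \<Longrightarrow> 2 \<le> deg \<alpha> \<Longrightarrow> divisor \<omega> \<alpha> e * coeff_at (\<Phi> e) \<alpha>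
    = (\<Sum>b | 2 \<le> deg b \<and> deg b \<le> deg \<alpha>. coeff_at (f e) b * coeff_at (power_product \<Phi> b) \<alpha>)"
  unfolding linearizes_def by blast

lemma linearizes_zero: "linearizes \<omega> f \<Phi> \<Longrightarrow> e \<in> units \<Longrightarrow> coeff_at (\<Phi> e) 0 = 0"
  using linearizes_low[of \<omega> f \<Phi> e 0] by (auto simp: deg_def units_def zero_prod_def)

lemma linearizes_unique:
  assumes irr: "\<omega> \<notin> \<rat>" and \<Phi>: "linearizes \<omega> f \<Phi>" and \<Psi>: "linearizes \<omega> f \<Psi>" and e: "e \<in> units"
  shows "\<Phi> e = \<Psi> e"
proof -
  have "\<forall>e\<in>units. \<forall>\<alpha>. deg \<alpha> \<le> n \<longrightarrow> coeff_at (\<Phi> e) \<alpha> = coeff_at (\<Psi> e) \<alpha>" for n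
  proof (induction n)
    case 0
    then show ?case using \<Phi> \<Psi> by (simp add: linearizes_zero)
  next
    case (Suc n)
    show ?case
    proof (intro ballI allI impI)
      fix e \<alpha> assume e: "e \<in> units" and \<alpha>: "deg \<alpha> \<le> Suc n"
      show "coeff_at (\<Phi> e) \<alpha> = coeff_at (\<Psi> e) \<alpha>"
      proof (cases "deg \<alpha> \<le> 1")
        case True
        then show ?thesis using linearizes_low[OF \<Phi> e] linearizes_low[OF \<Psi> e] by simp
      next
        case False
        have "coeff_at (power_product \<Phi> b) \<alpha> = coeff_at (power_product \<Psi> b) \<alpha>" if "2 \<le> deg b" for b
          by (rule coeff_at_power_product_cong[where n = n]) (use \<Phi> \<Psi> Suc that \<alpha> in \<open>auto simp: linearizes_zero\<close>)
        then have "divisor \<omega> \<alpha> e * coeff_at (\<Phi> e) \<alpha> = divisor \<omega> \<alpha> e * coeff_at (\<Psi> e) \<alpha>"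
          using False linearizes_eq[OF \<Phi> e, of \<alpha>] linearizes_eq[OF \<Psi> e, of \<alpha>] by simp
        then show ?thesis using divisor_nonzero[OF irr _ e, of \<alpha>] False by simp
      qed
    qed
  qed
  then show ?thesis using e by (intro fps2_eqI) blast
qed

definition linearization_step ::
  "real \<Rightarrow> (nat \<times> nat \<Rightarrow> fps2) \<Rightarrow> (nat \<times> nat \<Rightarrow> fps2) \<Rightarrow> nat \<times> nat \<Rightarrow> fps2" where
  "linearization_step \<omega> f \<Phi> e = Abs_fps (\<lambda>m. Abs_fps (\<lambda>n.
     if m + n \<le> 1 then (if (m, n) = e then 1 else 0)
     else (\<Sum>b | 2 \<le> deg b \<and> deg b \<le> m + n. coeff_at (f e) b * coeff_at (power_product \<Phi> b) (m, n))
       / complex_of_real (divisor \<omega> (m, n) e)))"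

lemma coeff_at_linearization_step:
  "coeff_at (linearization_step \<omega> f \<Phi> e) \<alpha> =
     (if deg \<alpha> \<le> 1 then (if \<alpha> = e then 1 else 0)
      else (\<Sum>b | 2 \<le> deg b \<and> deg b \<le> deg \<alpha>. coeff_at (f e) b * coeff_at (power_product \<Phi> b) \<alpha>)
       / complex_of_real (divisor \<omega> \<alpha> e))"
  by (cases \<alpha>) (simp add: linearization_step_def coeff_at_def[of "Abs_fps _"] coeff2_def deg_def[of "(_, _)"])

text \<open>
  Iterating the recursion, the \<open>n\<close>-th iterate is final in all degrees up to \<open>n + 1\<close>; the limit takes
  each coefficient from an iterate at which it has settled.
\<close>

lemma linearizes_exists:
  assumes irr: "\<omega> \<notin> \<rat>"
  shows "\<exists>\<Phi>. linearizes \<omega> f \<Phi>"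
proof -
  define it where "it n = (linearization_step \<omega> f ^^ n) (linearization_step \<omega> f (\<lambda>_. 0))" for n
  have it_Suc: "it (Suc n) = linearization_step \<omega> f (it n)" for n by (simp add: it_def)
  have it_low: "coeff_at (it n e) \<alpha> = (if \<alpha> = e then 1 else 0)" if "deg \<alpha> \<le> 1" for n e \<alpha>
    using that by (cases n) (simp_all add: it_def coeff_at_linearization_step)
  have it_0: "coeff_at (it n e) 0 = 0" if "e \<in> units" for n e
    using it_low[of 0 n e] that by (auto simp: deg_def units_def zero_prod_def)
  have step: "coeff_at (it n e) \<alpha> = coeff_at (it (Suc n) e) \<alpha>" if "e \<in> units" "deg \<alpha> \<le> Suc n" for n e \<alpha>
    using that
  proof (induction n arbitrary: e \<alpha>)
    case 0
    then show ?case by (simp add: it_low)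
  next
    case (Suc n)
    have "coeff_at (power_product (it n) b) \<alpha> = coeff_at (power_product (it (Suc n)) b) \<alpha>" if "2 \<le> deg b" for b
      by (rule coeff_at_power_product_cong[where n = "Suc n"]) (use Suc that in \<open>auto simp: it_0\<close>)
    then show ?case by (simp add: it_Suc[of "Suc n"] it_Suc[of n] coeff_at_linearization_step)
  qed
  have stable: "coeff_at (it n e) \<alpha> = coeff_at (it (n + k) e) \<alpha>" if "e \<in> units" "deg \<alpha> \<le> Suc n" for n k e \<alpha>
    using that
  proof (induction k)
    case (Suc k)
    then show ?case using step[of e \<alpha> "n + k"] by simp
  qed simp
  define \<Phi> where "\<Phi> e = Abs_fps (\<lambda>m. Abs_fps (\<lambda>n. coeff_at (it (m + n) e) (m, n)))" for e
  have coeff_\<Phi>: "coeff_at (\<Phi> e) \<alpha> = coeff_at (it (deg \<alpha>) e) \<alpha>" for e \<alpha>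
    by (cases \<alpha>) (simp add: \<Phi>_def coeff_at_def[of "Abs_fps _"] coeff2_def deg_def)
  have \<Phi>_it: "coeff_at (\<Phi> e) \<alpha> = coeff_at (it n e) \<alpha>" if "e \<in> units" "deg \<alpha> \<le> Suc n" for e \<alpha> n
  proof (cases "deg \<alpha> \<le> n")
    case True
    then show ?thesis using stable[of e \<alpha> "deg \<alpha>" "n - deg \<alpha>"] that by (simp add: coeff_\<Phi>)
  next
    case False
    then show ?thesis using step[of e \<alpha> n] that by (simp add: coeff_\<Phi> le_Suc_eq)
  qed
  have \<Phi>_0: "coeff_at (\<Phi> e) 0 = 0" if "e \<in> units" for e
    using \<Phi>_it[OF that, of 0 0] it_0[OF that] by (simp add: deg_def)
  have "linearizes \<omega> f \<Phi>"
    unfolding linearizes_def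
  proof (intro ballI allI conjI impI)
    fix e \<alpha> assume e: "e \<in> units"
    show "coeff_at (\<Phi> e) \<alpha> = (if \<alpha> = e then 1 else 0)" if "deg \<alpha> \<le> 1"
      using that by (simp add: coeff_\<Phi> it_low)
    assume \<alpha>: "2 \<le> deg \<alpha>"
    then obtain n where n: "deg \<alpha> = Suc n" by (cases "deg \<alpha>") auto
    have "coeff_at (power_product \<Phi> b) \<alpha> = coeff_at (power_product (it n) b) \<alpha>" if "2 \<le> deg b" for b
      by (rule coeff_at_power_product_cong[where n = n]) (use n that e in \<open>auto simp: \<Phi>_0 \<Phi>_it it_0\<close>)
    then have "(\<Sum>b | 2 \<le> deg b \<and> deg b \<le> deg \<alpha>. coeff_at (f e) b * coeff_at (power_product \<Phi> b) \<alpha>)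
      = divisor \<omega> \<alpha> e * coeff_at (it (Suc n) e) \<alpha>"
      using divisor_nonzero[OF irr \<alpha> e] \<alpha> by (simp add: it_Suc coeff_at_linearization_step)
    then show "divisor \<omega> \<alpha> e * coeff_at (\<Phi> e) \<alpha>
        = (\<Sum>b | 2 \<le> deg b \<and> deg b \<le> deg \<alpha>. coeff_at (f e) b * coeff_at (power_product \<Phi> b) \<alpha>)"
      by (simp add: coeff_\<Phi> n)
  qed
  then show ?thesis by blast
qed

section \<open>The majorant estimate\<close>

context bruno_bounded
begin

text \<open>
  Superadditivity of the weights makes the weighted coefficients submultiplicative.
\<close>

lemma power_product_weighted_sum_le:
  assumes zero: "\<And>e. e \<in> units \<Longrightarrow> coeff_at (\<Phi> e) 0 = 0" and r: "0 \<le> r"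
    and S: "\<And>e. e \<in> units \<Longrightarrow>
      (\<Sum>\<alpha> | deg \<alpha> \<le> n. norm (coeff_at (\<Phi> e) \<alpha>) * r ^ deg \<alpha> * exp (- weight \<omega> \<alpha> 1)) \<le> s"
  shows "(\<Sum>\<alpha> | deg \<alpha> < n + deg b.
    norm (coeff_at (power_product \<Phi> b) \<alpha>) * r ^ deg \<alpha> * exp (- weight \<omega> \<alpha> (deg b))) \<le> s ^ deg b"
proof (induction b rule: units_induct)
  case zero
  have "(\<Sum>\<alpha> | deg \<alpha> < n. norm (coeff_at 1 \<alpha>) * r ^ deg \<alpha> * exp (- weight \<omega> \<alpha> 0))
      \<le> (\<Sum>\<alpha> | deg \<alpha> < n. if \<alpha> = 0 then 1 else 0)"
    using weight_nonneg[of 0 0] by (intro sum_mono) (auto simp: coeff_at_1 deg_def)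
  also have "\<dots> \<le> 1" by (subst sum.delta) auto
  finally show ?case by (simp add: deg_def)
next
  case (add b e)
  let ?F = "\<lambda>\<alpha>. norm (coeff_at (power_product \<Phi> b) \<alpha>) * r ^ deg \<alpha> * exp (- weight \<omega> \<alpha> (deg b))"
  let ?G = "\<lambda>\<alpha>. norm (coeff_at (\<Phi> e) \<alpha>) * r ^ deg \<alpha> * exp (- weight \<omega> \<alpha> 1)"
  let ?H = "\<lambda>\<alpha>. norm (coeff_at (power_product \<Phi> (b + e)) \<alpha>) * r ^ deg \<alpha> * exp (- weight \<omega> \<alpha> (deg (b + e)))"
  have deg_be: "deg (b + e) = deg b + 1" using deg_unit[OF add.hyps] by simp
  have "?H \<alpha> \<le> (\<Sum>\<beta>\<in>below \<alpha>. ?F \<beta> * ?G (\<alpha> - \<beta>))" for \<alpha>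
  proof -
    have "norm (coeff_at (power_product \<Phi> (b + e)) \<alpha>)
        \<le> (\<Sum>\<beta>\<in>below \<alpha>. norm (coeff_at (power_product \<Phi> b) \<beta>) * norm (coeff_at (\<Phi> e) (\<alpha> - \<beta>)))"
      unfolding power_product_add_unit[OF add.hyps] coeff_at_mult norm_mult[symmetric] by (rule norm_sum)
    then have "?H \<alpha> \<le> (\<Sum>\<beta>\<in>below \<alpha>. norm (coeff_at (power_product \<Phi> b) \<beta>) * norm (coeff_at (\<Phi> e) (\<alpha> - \<beta>)))
        * r ^ deg \<alpha> * exp (- weight \<omega> \<alpha> (deg (b + e)))"
      using r by (intro mult_right_mono) auto
    also have "\<dots> = (\<Sum>\<beta>\<in>below \<alpha>. norm (coeff_at (power_product \<Phi> b) \<beta>) * norm (coeff_at (\<Phi> e) (\<alpha> - \<beta>))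
        * r ^ deg \<alpha> * exp (- weight \<omega> \<alpha> (deg (b + e))))"
      by (simp add: sum_distrib_right)
    also have "\<dots> \<le> (\<Sum>\<beta>\<in>below \<alpha>. ?F \<beta> * ?G (\<alpha> - \<beta>))"
    proof (rule sum_mono)
      fix \<beta> assume \<beta>: "\<beta> \<in> below \<alpha>"
      consider "deg \<beta> < deg b" | "\<alpha> - \<beta> = 0" | "deg b \<le> deg \<beta>" "1 \<le> deg (\<alpha> - \<beta>)"
        by (metis deg_0_iff less_one not_le)
      then show "norm (coeff_at (power_product \<Phi> b) \<beta>) * norm (coeff_at (\<Phi> e) (\<alpha> - \<beta>))
        * r ^ deg \<alpha> * exp (- weight \<omega> \<alpha> (deg (b + e))) \<le> ?F \<beta> * ?G (\<alpha> - \<beta>)"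
      proof cases
        case 1
        then show ?thesis using coeff_at_power_product_eq_0[OF zero] by simp
      next
        case 2
        then show ?thesis using zero add.hyps by simp
      next
        case 3
        have "weight \<omega> \<beta> (deg b) + weight \<omega> (\<alpha> - \<beta>) 1 \<le> weight \<omega> \<alpha> (deg (b + e))"
          using weight_superadditive[OF 3] below_diff(1)[OF \<beta>] deg_unit[OF add.hyps] by simp
        then have "exp (- weight \<omega> \<alpha> (deg (b + e)))
            \<le> exp (- weight \<omega> \<beta> (deg b)) * exp (- weight \<omega> (\<alpha> - \<beta>) 1)"
          by (simp flip: exp_add)
        then have "norm (coeff_at (power_product \<Phi> b) \<beta>) * norm (coeff_at (\<Phi> e) (\<alpha> - \<beta>)) * r ^ deg \<alpha>
            * exp (- weight \<omega> \<alpha> (deg (b + e)))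
          \<le> norm (coeff_at (power_product \<Phi> b) \<beta>) * norm (coeff_at (\<Phi> e) (\<alpha> - \<beta>)) * r ^ deg \<alpha>
            * (exp (- weight \<omega> \<beta> (deg b)) * exp (- weight \<omega> (\<alpha> - \<beta>) 1))"
          using r by (intro mult_left_mono) auto
        also have "\<dots> = ?F \<beta> * ?G (\<alpha> - \<beta>)"
          unfolding below_diff(2)[OF \<beta>, symmetric] power_add by (simp add: mult_ac)
        finally show ?thesis .
      qed
    qed
    finally show ?thesis .
  qed
  then have "(\<Sum>\<alpha> | deg \<alpha> < n + deg (b + e). ?H \<alpha>)
      \<le> (\<Sum>\<alpha> | deg \<alpha> < n + deg b + 1. \<Sum>\<beta>\<in>below \<alpha>. ?F \<beta> * ?G (\<alpha> - \<beta>))"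
    unfolding deg_be by (simp add: sum_mono)
  also have "\<dots> \<le> (\<Sum>\<alpha> | deg \<alpha> < n + deg b. ?F \<alpha>) * (\<Sum>\<alpha> | deg \<alpha> \<le> n. ?G \<alpha>)"
    by (rule convolution_sum_le) (use r zero add.hyps coeff_at_power_product_eq_0[OF zero] in auto)
  also have "\<dots> \<le> s ^ deg b * s"
  proof (rule mult_mono[OF add.IH S[OF add.hyps]])
    have "0 \<le> (\<Sum>\<alpha> | deg \<alpha> \<le> n. ?G \<alpha>)" using r by (intro sum_nonneg) auto
    then have "0 \<le> s" using S[OF add.hyps] by linarith
    then show "0 \<le> s ^ deg b" by simp
  qed (use r in \<open>intro sum_nonneg; simp\<close>)
  finally show ?case by (simp add: deg_unit[OF add.hyps] mult.commute)
qed

text \<open>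
  Up to truncation the sum is \<open>(1 - y)\<^sup>-\<^sup>2 - 1 - 2y\<close> at \<open>y = 1/16\<close>.
\<close>

lemma sum_powers_deg_ge_2: "(\<Sum>b | 2 \<le> deg b \<and> deg b \<le> n. (1/16) ^ deg b) \<le> (1/32 :: real)"
proof -
  define N where "N = Suc n"
  let ?A = "{..<Suc N} \<times> {..<Suc N}" and ?U = "{(0, 0), (1, 0), (0, 1)} :: (nat \<times> nat) set"
  have sub: "?U \<subseteq> ?A" by (auto simp: N_def)
  have "(\<Sum>b | 2 \<le> deg b \<and> deg b \<le> n. (1/16) ^ deg b) \<le> (\<Sum>b\<in>?A - ?U. (1/16 :: real) ^ deg b)"
    by (rule sum_mono2) (auto simp: deg_def N_def)
  also have "\<dots> = (\<Sum>b\<in>?A. (1/16 :: real) ^ deg b) - (\<Sum>b\<in>?U. (1/16) ^ deg b)"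
    by (rule sum_diff) (use sub in auto)
  also have "(\<Sum>b\<in>?A. (1/16 :: real) ^ deg b) = (\<Sum>i<Suc N. (1/16) ^ i)\<^sup>2"
    by (simp add: power2_eq_square sum_product sum.cartesian_product deg_def power_add case_prod_beta
        del: sum.lessThan_Suc)
  also have "(\<Sum>b\<in>?U. (1/16 :: real) ^ deg b) = 1 + 1/16 + 1/16" by (simp add: deg_def)
  also have "(\<Sum>i<Suc N. (1/16 :: real) ^ i) \<le> 16/15"
    by (subst sum_gp_strict) (simp add: field_simps)
  then have "(\<Sum>i<Suc N. (1/16 :: real) ^ i)\<^sup>2 \<le> (16/15)\<^sup>2"
    by (intro power_mono sum_nonneg) auto
  finally show ?thesis by (simp add: power2_eq_square)
qed

text \<open>
  The weighted coefficients satisfy a recursion without divisors, so their sums \<open>S\<^sub>n\<close> at radius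
  \<open>r = 1/32\<close> obey \<open>S\<^sub>n\<^sub>+\<^sub>1 \<le> r + \<Sum>\<^bsub>\<bar>b\<bar>\<ge>2\<^esub> S\<^sub>n\<^bsup>\<bar>b\<bar>\<^esup>\<close>, and \<open>S\<^sub>n \<le> 2 r\<close> is inherited.
\<close>

lemma linearizes_weighted_sum_le:
  assumes \<Phi>: "linearizes \<omega> f \<Phi>"
    and f: "\<And>e b. e \<in> units \<Longrightarrow> 2 \<le> deg b \<Longrightarrow> norm (coeff_at (f e) b) \<le> 1"
    and e: "e \<in> units"
  shows "(\<Sum>\<alpha> | deg \<alpha> \<le> n. norm (coeff_at (\<Phi> e) \<alpha>) * (1/32) ^ deg \<alpha> * exp (- weight \<omega> \<alpha> 1)) \<le> 1/16"
  using e
proof (induction n arbitrary: e)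
  case 0
  then show ?case by (simp add: linearizes_zero[OF \<Phi>])
next
  case (Suc n)
  let ?G = "\<lambda>\<alpha>. norm (coeff_at (\<Phi> e) \<alpha>) * (1/32) ^ deg \<alpha> * exp (- weight \<omega> \<alpha> 1)"
  let ?F = "\<lambda>b \<alpha>. norm (coeff_at (power_product \<Phi> b) \<alpha>) * (1/32) ^ deg \<alpha> * exp (- weight \<omega> \<alpha> (deg b))"
  let ?b = "{b. 2 \<le> deg b \<and> deg b \<le> Suc n}"
  let ?high = "{\<alpha>. 2 \<le> deg \<alpha> \<and> deg \<alpha> \<le> Suc n}"
  have fin: "finite {b. 2 \<le> deg b \<and> deg b \<le> m}" for m
    by (rule finite_subset[OF _ finite_deg_le[of m]]) auto
  have G_le: "?G \<alpha> \<le> (\<Sum>b\<in>?b. ?F b \<alpha>)" if \<alpha>: "\<alpha> \<in> ?high" for \<alpha>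
  proof -
    let ?d = "\<bar>divisor \<omega> \<alpha> e\<bar>"
    let ?b' = "{b. 2 \<le> deg b \<and> deg b \<le> deg \<alpha>}"
    have d: "0 < ?d" using divisor_nonzero[OF irr _ Suc.prems, of \<alpha>] \<alpha> by simp
    have "?d * norm (coeff_at (\<Phi> e) \<alpha>) = norm (\<Sum>b\<in>?b'. coeff_at (f e) b * coeff_at (power_product \<Phi> b) \<alpha>)"
      using \<alpha> by (simp flip: linearizes_eq[OF \<Phi> Suc.prems] add: norm_mult)
    also have "\<dots> \<le> (\<Sum>b\<in>?b'. norm (coeff_at (power_product \<Phi> b) \<alpha>))"
    proof (rule sum_norm_le)
      fix b assume "b \<in> ?b'"
      then have "norm (coeff_at (f e) b) \<le> 1" using f[OF Suc.prems] by simp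
      then show "norm (coeff_at (f e) b * coeff_at (power_product \<Phi> b) \<alpha>) \<le> norm (coeff_at (power_product \<Phi> b) \<alpha>)"
        by (simp add: norm_mult mult_left_le_one_le)
    qed
    finally have "norm (coeff_at (\<Phi> e) \<alpha>) \<le> (\<Sum>b\<in>?b'. norm (coeff_at (power_product \<Phi> b) \<alpha>)) / ?d"
      using d by (simp add: field_simps)
    then have "?G \<alpha> \<le> (\<Sum>b\<in>?b'. norm (coeff_at (power_product \<Phi> b) \<alpha>)) / ?d * (1/32) ^ deg \<alpha>
        * exp (- weight \<omega> \<alpha> 1)"
      by (intro mult_right_mono) auto
    also have "\<dots> = (\<Sum>b\<in>?b'. norm (coeff_at (power_product \<Phi> b) \<alpha>) * (1/32) ^ deg \<alpha>
        * (exp (- weight \<omega> \<alpha> 1) / ?d))"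
      by (simp add: sum_distrib_right sum_divide_distrib)
    also have "\<dots> \<le> (\<Sum>b\<in>?b'. ?F b \<alpha>)"
    proof (intro sum_mono mult_left_mono)
      fix b assume "b \<in> ?b'"
      then have "- weight \<omega> \<alpha> 1 \<le> - weight \<omega> \<alpha> (deg b) + ln ?d"
        using weight_node[of "deg b" \<alpha> e] Suc.prems by simp
      then have "exp (- weight \<omega> \<alpha> 1) \<le> exp (- weight \<omega> \<alpha> (deg b)) * ?d"
        using d by (metis exp_add exp_le_cancel_iff exp_ln)
      then show "exp (- weight \<omega> \<alpha> 1) / ?d \<le> exp (- weight \<omega> \<alpha> (deg b))"
        using d by (simp add: field_simps)
    qed auto
    also have "\<dots> \<le> (\<Sum>b\<in>?b. ?F b \<alpha>)"
      by (rule sum_mono2[OF fin]) (use \<alpha> in auto)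
    finally show ?thesis .
  qed
  have "(\<Sum>\<alpha>\<in>?high. ?G \<alpha>) \<le> (\<Sum>\<alpha>\<in>?high. \<Sum>b\<in>?b. ?F b \<alpha>)"
    by (intro sum_mono G_le)
  also have "\<dots> = (\<Sum>b\<in>?b. \<Sum>\<alpha>\<in>?high. ?F b \<alpha>)" by (rule sum.swap)
  also have "\<dots> \<le> (\<Sum>b\<in>?b. (1/16) ^ deg b)"
  proof (rule sum_mono)
    fix b assume b: "b \<in> ?b"
    have "(\<Sum>\<alpha>\<in>?high. ?F b \<alpha>) \<le> (\<Sum>\<alpha> | deg \<alpha> < n + deg b. ?F b \<alpha>)"
      by (rule sum_mono2) (use b in auto)
    also have "\<dots> \<le> (1/16) ^ deg b"
      by (rule power_product_weighted_sum_le) (use linearizes_zero[OF \<Phi>] Suc.IH in auto)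
    finally show "(\<Sum>\<alpha>\<in>?high. ?F b \<alpha>) \<le> (1/16) ^ deg b" .
  qed
  also have "\<dots> \<le> 1/32" by (rule sum_powers_deg_ge_2)
  finally have high: "(\<Sum>\<alpha>\<in>?high. ?G \<alpha>) \<le> 1/32" .
  have "(\<Sum>\<alpha> | deg \<alpha> \<le> 1. ?G \<alpha>) \<le> (\<Sum>\<alpha> | deg \<alpha> \<le> 1. if \<alpha> = e then 1/32 else 0)"
  proof (rule sum_mono)
    fix \<alpha> assume \<alpha>: "\<alpha> \<in> {\<alpha>. deg \<alpha> \<le> 1}"
    show "?G \<alpha> \<le> (if \<alpha> = e then 1/32 else 0)"
      using linearizes_low[OF \<Phi> Suc.prems, of \<alpha>] \<alpha> weight_nonneg[of 1 e] deg_unit[OF Suc.prems]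
      by auto
  qed
  also have "\<dots> \<le> 1/32" by (subst sum.delta) auto
  finally have low: "(\<Sum>\<alpha> | deg \<alpha> \<le> 1. ?G \<alpha>) \<le> 1/32" .
  have "{\<alpha>. deg \<alpha> \<le> Suc n} = {\<alpha>. deg \<alpha> \<le> 1} \<union> ?high" by auto
  then have "(\<Sum>\<alpha> | deg \<alpha> \<le> Suc n. ?G \<alpha>) = (\<Sum>\<alpha> | deg \<alpha> \<le> 1. ?G \<alpha>) + (\<Sum>\<alpha>\<in>?high. ?G \<alpha>)"
    using fin by (simp only:) (rule sum.union_disjoint, auto)
  then show ?case using low high by linarith
qed

lemma rate_nonneg: "0 \<le> rate"
  using B[of 0] by (simp add: rate_def add_nonneg_nonneg)

lemma linearizes_coeff_le:
  assumes \<Phi>: "linearizes \<omega> f \<Phi>"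
    and f: "\<And>e b. e \<in> units \<Longrightarrow> 2 \<le> deg b \<Longrightarrow> norm (coeff_at (f e) b) \<le> 1"
    and e: "e \<in> units"
  shows "norm (coeff_at (\<Phi> e) \<alpha>) \<le> (32 * exp rate) ^ deg \<alpha>"
proof (cases "\<alpha> = 0")
  case True
  then show ?thesis using linearizes_zero[OF \<Phi> e] by simp
next
  case False
  then have d: "1 \<le> deg \<alpha>" by (metis deg_0_iff less_one not_le)
  let ?G = "\<lambda>\<alpha>. norm (coeff_at (\<Phi> e) \<alpha>) * (1/32) ^ deg \<alpha> * exp (- weight \<omega> \<alpha> 1)"
  have "?G \<alpha> \<le> (\<Sum>\<alpha>' | deg \<alpha>' \<le> deg \<alpha>. ?G \<alpha>')"
    by (rule member_le_sum) auto
  also have "\<dots> \<le> 1" using linearizes_weighted_sum_le[OF \<Phi> f e, of "deg \<alpha>"] by simp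
  finally have "norm (coeff_at (\<Phi> e) \<alpha>) \<le> 32 ^ deg \<alpha> * exp (weight \<omega> \<alpha> 1)"
    by (simp add: exp_minus field_simps)
  also have "weight \<omega> \<alpha> 1 \<le> real (deg \<alpha>) * rate"
  proof -
    have "weight \<omega> \<alpha> 1 \<le> (real (deg \<alpha>) - 1) * rate" using weight_le_rate[OF d] by simp
    also have "\<dots> \<le> real (deg \<alpha>) * rate" using rate_nonneg by (intro mult_right_mono) auto
    finally show ?thesis .
  qed
  then have "32 ^ deg \<alpha> * exp (weight \<omega> \<alpha> 1) \<le> 32 ^ deg \<alpha> * exp (real (deg \<alpha>) * rate)" by simp
  also have "\<dots> = (32 * exp rate) ^ deg \<alpha>" by (simp add: power_mult_distrib exp_of_nat_mult)
  finally show ?thesis .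
qed

end

section \<open>Uniqueness of Taylor coefficients\<close>

lemma powser_zero_imp_coeff_zero:
  fixes a :: "nat \<Rightarrow> complex"
  assumes "\<And>z. norm z < 1 \<Longrightarrow> (\<lambda>n. a n * z ^ n) sums 0"
  shows "a n = 0"
proof (induction n rule: less_induct)
  case (less n)
  have shifted: "(\<lambda>k. a (k + n) * z ^ k) sums 0" if "z \<noteq> 0" "norm z < 1" for z
  proof -
    have "(\<lambda>k. a (k + n) * z ^ (k + n)) sums (0 - (\<Sum>i<n. a i * z ^ i))"
      by (rule sums_split_initial_segment[OF assms[OF that(2)]])
    then have "(\<lambda>k. a (k + n) * z ^ (k + n)) sums 0" using less by simp
    then have "(\<lambda>k. a (k + n) * z ^ (k + n) / z ^ n) sums (0 / z ^ n)" by (rule sums_divide)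
    then show ?thesis using that by (simp add: power_add)
  qed
  have "((\<lambda>_::complex. 0) \<longlongrightarrow> (\<lambda>k. a (k + n)) 0) (at 0)"
    by (rule powser_limit_0_strong[where a = "\<lambda>k. a (k + n)" and f = "\<lambda>_. 0",
          OF zero_less_one shifted])
  then show ?case by (simp add: tendsto_const_iff)
qed

text \<open>
  The double series is summed first over the second index; its coefficients as a power series in
  \<open>z1\<close> vanish, and each of them is a power series in \<open>z2\<close>.
\<close>

lemma has_expansion_unique:
  assumes "has_expansion G g" "has_expansion G g'"
  shows "g = g'"
proof (rule fps2_eqI)
  fix \<alpha>
  define c where "c m n = coeff2 g m n - coeff2 g' m n" for m n
  have sum: "((\<lambda>(m, n). c m n * z1 ^ m * z2 ^ n) has_sum 0) UNIV" if "norm z1 < 1" "norm z2 < 1" for z1 z2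
  proof -
    have "((\<lambda>x. (case x of (m, n) \<Rightarrow> coeff2 g m n * z1 ^ m * z2 ^ n)
        + - (case x of (m, n) \<Rightarrow> coeff2 g' m n * z1 ^ m * z2 ^ n))
        has_sum (G (z1, z2) + - G (z1, z2))) UNIV"
      using assms that unfolding has_expansion_def
      by (intro has_sum_add has_sum_uminusI) auto
    then show ?thesis by (simp add: c_def case_prod_unfold algebra_simps)
  qed
  have inner: "(\<lambda>n. c m n * z2 ^ n) summable_on UNIV" if "norm z2 < 1" for m z2
  proof -
    have "(\<lambda>(m, n). c m n * (1/2) ^ m * z2 ^ n) summable_on UNIV \<times> UNIV"
      using sum[of "1/2" z2] that by (auto simp: summable_on_def)
    then have "(\<lambda>n. c m n * (1/2) ^ m * z2 ^ n) summable_on UNIV"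
      by (rule summable_on_SigmaD1) simp
    then have "(\<lambda>n. c m n * (1/2) ^ m * z2 ^ n * 2 ^ m) summable_on UNIV"
      by (rule summable_on_cmult_left)
    then show ?thesis by (simp add: power_one_over mult_ac)
  qed
  have outer: "(\<lambda>m. (\<Sum>\<^sub>\<infinity>n. c m n * z2 ^ n) * z1 ^ m) sums 0"
    if z: "norm z1 < 1" "norm z2 < 1" for z1 z2
  proof (rule has_sum_imp_sums, rule has_sum_SigmaD[where A = UNIV and B = "\<lambda>_. UNIV"])
    show "((\<lambda>(m, n). c m n * z1 ^ m * z2 ^ n) has_sum 0) (UNIV \<times> UNIV)"
      using sum[OF z] by simp
    show "((\<lambda>n. case (m, n) of (m, n) \<Rightarrow> c m n * z1 ^ m * z2 ^ n)
      has_sum (\<Sum>\<^sub>\<infinity>n. c m n * z2 ^ n) * z1 ^ m) UNIV" for m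
      using has_sum_cmult_left[OF has_sum_infsum[OF inner[OF z(2), of m]], of "z1 ^ m"]
      by (simp add: mult_ac)
  qed
  have zero: "(\<Sum>\<^sub>\<infinity>n. c m n * z2 ^ n) = 0" if "norm z2 < 1" for m z2
    by (rule powser_zero_imp_coeff_zero[where a = "\<lambda>m. \<Sum>\<^sub>\<infinity>n. c m n * z2 ^ n",
          OF outer[OF _ that]])
  have "(\<lambda>n. c m n * z ^ n) sums 0" if "norm z < 1" for m z
    using has_sum_imp_sums[OF has_sum_infsum[OF inner[OF that, of m]]] zero[OF that, of m] by simp
  then have "c m n = 0" for m n by (rule powser_zero_imp_coeff_zero[where a = "c m"])
  then show "coeff_at g \<alpha> = coeff_at g' \<alpha>" by (simp add: coeff_at_def c_def)
qed

section \<open>From the linearization to coefficient equations\<close>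

lemma coeff_at_var:
  "coeff_at var1 \<alpha> = (if \<alpha> = (1, 0) then 1 else 0)" "coeff_at var2 \<alpha> = (if \<alpha> = (0, 1) then 1 else 0)"
  by (cases \<alpha>; auto simp: coeff_at_def coeff2_def var1_def var2_def)+

lemma coeff_at_deriv_along: "coeff_at (deriv_along \<omega> H) \<alpha> = eigen \<omega> \<alpha> * coeff_at H \<alpha>"
proof (cases \<alpha>)
  case (Pair m n)
  have "fps_nth (pderiv1 H * (const2 (-1) * var1)) m = - of_nat m * fps_nth H m"
    by (cases m) (simp_all add: pderiv1_def const2_def var1_def algebra_simps flip: fps_const_neg)
  moreover have "fps_nth (fps_nth (pderiv2 H * (const2 (of_real \<omega>) * var2)) m) n
    = of_real \<omega> * of_nat n * fps_nth (fps_nth H m) n"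
  proof -
    have comm: "fps_deriv G * (fps_const c * fps_X) = fps_const c * (fps_deriv G * fps_X)" for G and c :: complex
      by (simp only: mult_ac)
    have "fps_nth (fps_deriv G * (fps_const c * fps_X)) n = c * of_nat n * fps_nth G n" for G and c :: complex
      unfolding comm by (cases n) simp_all
    then show ?thesis by (simp add: pderiv2_def const2_def var2_def)
  qed
  moreover have "fps_nth (- of_nat m * fps_nth H m) n = - of_nat m * fps_nth (fps_nth H m) n"
    by (simp flip: fps_of_nat)
  ultimately show ?thesis
    using Pair by (simp add: coeff_at_def coeff2_def deriv_along_def eigen_def algebra_simps)
qed

lemma coeff_at_subst2:
  "coeff_at (subst2 f (\<Phi> (1, 0)) (\<Phi> (0, 1))) \<alpha> = (\<Sum>b | deg b \<le> deg \<alpha>. coeff_at f b * coeff_at (power_product \<Phi> b) \<alpha>)"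
proof -
  have "coeff_at (subst2 f (\<Phi> (1, 0)) (\<Phi> (0, 1))) \<alpha>
    = (\<Sum>(a, b) | a + b \<le> deg \<alpha>. coeff_at f (a, b) * coeff_at (power_product \<Phi> (a, b)) \<alpha>)"
    by (simp only: subst2_def coeff_at_def coeff2_def power_product_def deg_def fst_conv snd_conv fps_nth_Abs_fps)
  also have "\<dots> = (\<Sum>b | deg b \<le> deg \<alpha>. coeff_at f b * coeff_at (power_product \<Phi> b) \<alpha>)"
    by (rule sum.cong) (auto simp: deg_def[of "(_, _)"])
  finally show ?thesis .
qed

lemma sum_deg_split:
  fixes g :: "nat \<times> nat \<Rightarrow> complex"
  assumes "1 \<le> m"
  shows "(\<Sum>b | deg b \<le> m. g b)
    = g 0 + g (1, 0) + g (0, 1) + (\<Sum>b | 2 \<le> deg b \<and> deg b \<le> m. g b)"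
proof -
  have "{b. deg b \<le> m} = {0, (1, 0), (0, 1)} \<union> {b. 2 \<le> deg b \<and> deg b \<le> m}"
  proof (intro equalityI subsetI)
    fix b assume b: "b \<in> {b. deg b \<le> m}"
    consider "deg b = 0" | "deg b = 1" | "2 \<le> deg b" by linarith
    then show "b \<in> {0, (1, 0), (0, 1)} \<union> {b. 2 \<le> deg b \<and> deg b \<le> m}"
      using b deg_1_iff[of b] by cases (auto simp: units_def)
  qed (use assms in \<open>auto simp: deg_def\<close>)
  moreover have "finite {b. 2 \<le> deg b \<and> deg b \<le> m}"
    by (rule finite_subset[OF _ finite_deg_le[of m]]) auto
  ultimately have "(\<Sum>b | deg b \<le> m. g b)
      = (\<Sum>b\<in>{0, (1, 0), (0, 1)}. g b) + (\<Sum>b | 2 \<le> deg b \<and> deg b \<le> m. g b)"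
    by (simp only:) (rule sum.union_disjoint, auto simp: deg_def)
  then show ?thesis by (simp add: zero_prod_def)
qed

definition by_unit :: "fps2 \<Rightarrow> fps2 \<Rightarrow> nat \<times> nat \<Rightarrow> fps2" where
  "by_unit a b e = (if e = (1, 0) then a else b)"

definition diag_linear_part :: "real \<Rightarrow> (nat \<times> nat \<Rightarrow> fps2) \<Rightarrow> bool" where
  "diag_linear_part \<omega> f \<longleftrightarrow> (\<forall>e\<in>units. coeff_at (f e) 0 = 0 \<and>
     (\<forall>e'\<in>units. coeff_at (f e) e' = (if e' = e then of_real (eigen \<omega> e) else 0)))"

lemma conjugacy_iff_linearizes:
  assumes f: "diag_linear_part \<omega> f"
    and low: "\<And>e \<alpha>. e \<in> units \<Longrightarrow> deg \<alpha> \<le> 1 \<Longrightarrow> coeff_at (\<Phi> e) \<alpha> = (if \<alpha> = e then 1 else 0)"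
  shows "(\<forall>e\<in>units. deriv_along \<omega> (\<Phi> e) = subst2 (f e) (\<Phi> (1, 0)) (\<Phi> (0, 1)))
    \<longleftrightarrow> linearizes \<omega> f \<Phi>"
proof -
  let ?S = "\<lambda>e \<alpha>. \<Sum>b | 2 \<le> deg b \<and> deg b \<le> deg \<alpha>. coeff_at (f e) b * coeff_at (power_product \<Phi> b) \<alpha>"
  have coeff_eq: "coeff_at (subst2 (f e) (\<Phi> (1, 0)) (\<Phi> (0, 1))) \<alpha> = eigen \<omega> e * coeff_at (\<Phi> e) \<alpha> + ?S e \<alpha>"
    if e: "e \<in> units" for e \<alpha>
  proof (cases "1 \<le> deg \<alpha>")
    case True
    have "coeff_at (f e) 0 = 0" "coeff_at (f e) (1, 0) = (if (1, 0) = e then of_real (eigen \<omega> e) else 0)"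
      "coeff_at (f e) (0, 1) = (if (0, 1) = e then of_real (eigen \<omega> e) else 0)"
      using f e by (auto simp: diag_linear_part_def units_def)
    moreover have "power_product \<Phi> (1, 0) = \<Phi> (1, 0)" "power_product \<Phi> (0, 1) = \<Phi> (0, 1)" by (simp_all add: power_product_def)
    ultimately show ?thesis
      unfolding coeff_at_subst2 sum_deg_split[OF True] using e by (auto simp: units_def)
  next
    case False
    then have "\<alpha> = 0" by (metis deg_0_iff less_one not_le)
    have "coeff_at (\<Phi> e) 0 = 0" using low[OF e, of 0] e by (auto simp: units_def deg_def zero_prod_def)
    moreover have "{b. deg b \<le> 0} = {0}" by (simp)
    moreover have "{b. 2 \<le> deg b \<and> deg b \<le> 0} = {}" by auto
    moreover have "coeff_at (f e) 0 = 0" using f e by (auto simp: diag_linear_part_def)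
    moreover have "deg 0 = 0" by simp
    ultimately show ?thesis unfolding coeff_at_subst2 \<open>\<alpha> = 0\<close> by (simp only:) simp
  qed
  have "deriv_along \<omega> (\<Phi> e) = subst2 (f e) (\<Phi> (1, 0)) (\<Phi> (0, 1))
    \<longleftrightarrow> (\<forall>\<alpha>. 2 \<le> deg \<alpha> \<longrightarrow> divisor \<omega> \<alpha> e * coeff_at (\<Phi> e) \<alpha> = ?S e \<alpha>)" if e: "e \<in> units" for e
  proof -
    have "deriv_along \<omega> (\<Phi> e) = subst2 (f e) (\<Phi> (1, 0)) (\<Phi> (0, 1))
      \<longleftrightarrow> (\<forall>\<alpha>. eigen \<omega> \<alpha> * coeff_at (\<Phi> e) \<alpha> = eigen \<omega> e * coeff_at (\<Phi> e) \<alpha> + ?S e \<alpha>)"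
      using coeff_eq[OF e] coeff_at_deriv_along by (metis fps2_eqI)
    also have "\<dots> \<longleftrightarrow> (\<forall>\<alpha>. divisor \<omega> \<alpha> e * coeff_at (\<Phi> e) \<alpha> = ?S e \<alpha>)"
      by (simp add: divisor_def algebra_simps diff_eq_eq)
    also have "\<dots> \<longleftrightarrow> (\<forall>\<alpha>. 2 \<le> deg \<alpha> \<longrightarrow> divisor \<omega> \<alpha> e * coeff_at (\<Phi> e) \<alpha> = ?S e \<alpha>)"
    proof -
      have "divisor \<omega> \<alpha> e * coeff_at (\<Phi> e) \<alpha> = ?S e \<alpha>" if "\<not> 2 \<le> deg \<alpha>" for \<alpha>
      proof -
        have "{b. 2 \<le> deg b \<and> deg b \<le> deg \<alpha>} = {}" using that by auto
        moreover have "divisor \<omega> \<alpha> e * coeff_at (\<Phi> e) \<alpha> = 0"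
          using low[OF e, of \<alpha>] that by (auto simp: divisor_def)
        ultimately show ?thesis by (simp only: sum.empty)
      qed
      then show ?thesis by blast
    qed
    finally show ?thesis .
  qed
  then show ?thesis using low unfolding linearizes_def by blast
qed

lemma is_linearization_iff:
  assumes "has_expansion (\<lambda>z. fst (F z)) f1" "has_expansion (\<lambda>z. snd (F z)) f2"
    and "diag_linear_part \<omega> (by_unit f1 f2)"
  shows "is_linearization \<omega> F (h1, h2)
    \<longleftrightarrow> linearizes \<omega> (by_unit f1 f2) (by_unit (var1 + h1) (var2 + h2))"
proof -
  let ?\<Phi> = "by_unit (var1 + h1) (var2 + h2)"
  let ?low = "\<forall>m n. m + n \<le> 1 \<longrightarrow> coeff2 h1 m n = 0 \<and> coeff2 h2 m n = 0"
  have low: "?low \<longleftrightarrow> (\<forall>e\<in>units. \<forall>\<alpha>. deg \<alpha> \<le> 1 \<longrightarrow> coeff_at (?\<Phi> e) \<alpha> = (if \<alpha> = e then 1 else 0))"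
    by (simp add: units_def by_unit_def coeff_at_add coeff_at_var deg_def) (auto simp: coeff_at_def)
  have "is_linearization \<omega> F (h1, h2) \<longleftrightarrow> ?low \<and>
      (\<forall>e\<in>units. deriv_along \<omega> (?\<Phi> e) = subst2 (by_unit f1 f2 e) (?\<Phi> (1, 0)) (?\<Phi> (0, 1)))"
    using assms(1,2) has_expansion_unique
    unfolding is_linearization_def by (auto simp: units_def by_unit_def)
  also have "\<dots> \<longleftrightarrow> linearizes \<omega> (by_unit f1 f2) ?\<Phi>"
  proof (cases ?low)
    case True
    then show ?thesis
      using conjugacy_iff_linearizes[OF assms(3), of ?\<Phi>] low by blast
  next
    case False
    then have "\<not> linearizes \<omega> (by_unit f1 f2) ?\<Phi>" unfolding low linearizes_def by blast
    then show ?thesis using False by blast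
  qed
  finally show ?thesis .
qed

lemma linearizes_cong:
  assumes "\<And>e. e \<in> units \<Longrightarrow> \<Phi> e = \<Psi> e"
  shows "linearizes \<omega> f \<Phi> \<longleftrightarrow> linearizes \<omega> f \<Psi>"
proof -
  have "\<Phi> (1, 0) = \<Psi> (1, 0)" "\<Phi> (0, 1) = \<Psi> (0, 1)"
    by (rule assms; simp add: units_def)+
  then have products: "power_product \<Phi> = power_product \<Psi>" unfolding power_product_def by (simp only:)
  show ?thesis
    unfolding linearizes_def products by (rule ball_cong[OF refl]) (simp only: assms)
qed

text \<open>
  Existence and uniqueness of the solution of the recursion identify the description operator in
  \<^const>\<open>linearization\<close> with the series to which the estimates apply.
\<close>

lemma linearization_linearizes:
  assumes "\<omega> \<notin> \<rat>" "F \<in> vector_fields \<omega>"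
  obtains f \<Phi> where "linearizes \<omega> f \<Phi>"
    "\<And>e b. e \<in> units \<Longrightarrow> 2 \<le> deg b \<Longrightarrow> norm (coeff_at (f e) b) \<le> 1"
    "\<Phi> (1, 0) = var1 + fst (linearization \<omega> F)" "\<Phi> (0, 1) = var2 + snd (linearization \<omega> F)"
proof -
  obtain f1 f2 where ex: "has_expansion (\<lambda>z. fst (F z)) f1" "has_expansion (\<lambda>z. snd (F z)) f2"
    and lin: "coeff2 f1 0 0 = 0" "coeff2 f1 1 0 = -1" "coeff2 f1 0 1 = 0"
      "coeff2 f2 0 0 = 0" "coeff2 f2 1 0 = 0" "coeff2 f2 0 1 = of_real \<omega>"
    and bound: "\<forall>m n. m + n \<ge> 2 \<longrightarrow> norm (coeff2 f1 m n) \<le> 1 \<and> norm (coeff2 f2 m n) \<le> 1"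
    using assms(2) unfolding vector_fields_def mem_Collect_eq by (elim exE conjE) (rule that)
  let ?f = "by_unit f1 f2"
  have diag: "diag_linear_part \<omega> ?f"
    using lin by (simp add: diag_linear_part_def units_def by_unit_def coeff_at_def eigen_def)
  obtain \<Phi> where \<Phi>: "linearizes \<omega> ?f \<Phi>" using linearizes_exists[OF assms(1)] by blast
  define h1 where "h1 = \<Phi> (1, 0) - var1"
  define h2 where "h2 = \<Phi> (0, 1) - var2"
  have *: "linearizes \<omega> ?f (by_unit a b) \<longleftrightarrow> a = \<Phi> (1, 0) \<and> b = \<Phi> (0, 1)" for a b
  proof
    assume "linearizes \<omega> ?f (by_unit a b)"
    then have "by_unit a b e = \<Phi> e" if "e \<in> units" for e
      using linearizes_unique[OF assms(1) _ \<Phi> that] by blast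
    from this[of "(1, 0)"] this[of "(0, 1)"] show "a = \<Phi> (1, 0) \<and> b = \<Phi> (0, 1)"
      by (simp add: units_def by_unit_def)
  next
    assume "a = \<Phi> (1, 0) \<and> b = \<Phi> (0, 1)"
    then have "by_unit a b e = \<Phi> e" if "e \<in> units" for e using that by (auto simp: units_def by_unit_def)
    then show "linearizes \<omega> ?f (by_unit a b)" using \<Phi> linearizes_cong by blast
  qed
  have "is_linearization \<omega> F h \<longleftrightarrow> h = (h1, h2)" for h
  proof (cases h)
    case (Pair a b)
    then show ?thesis
      using is_linearization_iff[OF ex diag, of a b] *[of "var1 + a" "var2 + b"]
      by (auto simp: h1_def h2_def algebra_simps)
  qed
  then have h: "linearization \<omega> F = (h1, h2)"
    unfolding linearization_def by (intro the_equality) simp_all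
  show ?thesis
  proof (rule that[OF \<Phi>])
    show "norm (coeff_at (?f e) b) \<le> 1" if "e \<in> units" "2 \<le> deg b" for e b
      using that(2) bound by (simp add: by_unit_def coeff_at_def deg_def)
  qed (simp_all add: h h1_def h2_def)
qed

section \<open>The domain of convergence\<close>

lemma powser2_summable:
  assumes H: "\<And>\<alpha>. norm (coeff_at H \<alpha>) \<le> R ^ deg \<alpha>" and R: "0 < R"
    and z: "norm z1 < 1 / R" "norm z2 < 1 / R"
  shows "(\<lambda>(m, n). coeff2 H m n * z1 ^ m * z2 ^ n) summable_on UNIV"
proof -
  have geo: "(\<lambda>n. (R * norm z) ^ n) summable_on UNIV" if "norm z < 1 / R" for z :: complex
  proof (rule norm_summable_imp_summable_on)
    have "R * norm z < 1" using that R by (simp add: field_simps)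
    then show "summable (\<lambda>n. norm ((R * norm z) ^ n))"
      using R by (simp add: summable_geometric abs_mult power_abs)
  qed
  have "(\<lambda>(m, n). (R * norm z1) ^ m * (R * norm z2) ^ n) summable_on Sigma UNIV (\<lambda>_. UNIV)"
  proof (rule summable_on_SigmaI)
    show "((\<lambda>n. case (m, n) of (m, n) \<Rightarrow> (R * norm z1) ^ m * (R * norm z2) ^ n)
      has_sum (R * norm z1) ^ m * (\<Sum>\<^sub>\<infinity>n. (R * norm z2) ^ n)) UNIV" for m
      using has_sum_cmult_right[OF has_sum_infsum[OF geo[OF z(2)]]] by simp
    show "(\<lambda>m. (R * norm z1) ^ m * (\<Sum>\<^sub>\<infinity>n. (R * norm z2) ^ n)) summable_on UNIV"
      by (rule summable_on_cmult_left[OF geo[OF z(1)]])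
  qed (use R in simp)
  then have "(\<lambda>x. norm (case x of (m, n) \<Rightarrow> (R * norm z1) ^ m * (R * norm z2) ^ n)) summable_on UNIV"
    using R by (simp add: case_prod_unfold abs_mult)
  then have "(\<lambda>x. norm (case x of (m, n) \<Rightarrow> coeff2 H m n * z1 ^ m * z2 ^ n)) summable_on UNIV"
  proof (rule Infinite_Sum.abs_summable_on_comparison_test)
    fix x :: "nat \<times> nat"
    obtain m n where x: "x = (m, n)" by (cases x)
    have "norm (coeff2 H m n * z1 ^ m * z2 ^ n) \<le> R ^ (m + n) * norm z1 ^ m * norm z2 ^ n"
      using H[of "(m, n)"] unfolding norm_mult norm_power
      by (intro mult_right_mono) (auto simp: coeff_at_def deg_def)
    also have "\<dots> = norm ((R * norm z1) ^ m * (R * norm z2) ^ n)"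
      using R by (simp add: power_add power_mult_distrib abs_mult)
    finally show "norm (case x of (m, n) \<Rightarrow> coeff2 H m n * z1 ^ m * z2 ^ n)
      \<le> norm (case x of (m, n) \<Rightarrow> (R * norm z1) ^ m * (R * norm z2) ^ n)" by (simp add: x)
  qed
  then show ?thesis by (rule Infinite_Sum.abs_summable_summable)
qed

lemma polydisc_subset_convergence_domain:
  assumes "\<And>\<alpha>. norm (coeff_at (fst h) \<alpha>) \<le> R ^ deg \<alpha>" "\<And>\<alpha>. norm (coeff_at (snd h) \<alpha>) \<le> R ^ deg \<alpha>"
    and "0 < R"
  shows "ball 0 (1 / R) \<times> ball 0 (1 / R) \<subseteq> convergence_domain h"
  unfolding convergence_domain_def
proof (rule interior_maximal)
  show "open (ball 0 (1 / R) \<times> ball 0 (1 / R) :: (complex \<times> complex) set)"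
    by (intro open_Times) auto
qed (auto intro!: powser2_summable assms)

lemma boundary_dist_ge:
  assumes "ball 0 \<rho> \<times> ball 0 \<rho> \<subseteq> convergence_domain (linearization \<omega> F)" and "0 < \<rho>"
  shows "ereal \<rho> \<le> boundary_dist \<omega> F"
proof -
  let ?R = "convergence_domain (linearization \<omega> F)"
  have "(0, 0) \<in> ?R" using assms by auto
  moreover have "\<rho> \<le> norm z" if "z \<in> frontier ?R" for z
  proof (rule ccontr)
    assume "\<not> \<rho> \<le> norm z"
    then have "norm (fst z) < \<rho>" "norm (snd z) < \<rho>"
      using norm_fst_le[of "fst z" "snd z"] norm_snd_le[of "snd z" "fst z"] by simp_all
    then have "z \<in> ?R" using assms(1) by (cases z) auto
    moreover have "open ?R" by (simp add: convergence_domain_def)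
    ultimately show False using that by (simp add: frontier_def interior_open)
  qed
  ultimately show ?thesis by (auto simp: boundary_dist_def Let_def intro!: INF_greatest)
qed

lemma (in bruno_bounded) family_dist_ge: "ereal (1 / (32 * exp rate)) \<le> family_dist \<omega>"
  unfolding family_dist_def
proof (rule INF_greatest)
  fix F assume "F \<in> vector_fields \<omega>"
  then obtain f \<Phi> where \<Phi>: "linearizes \<omega> f \<Phi>"
    "\<And>e b. e \<in> units \<Longrightarrow> 2 \<le> deg b \<Longrightarrow> norm (coeff_at (f e) b) \<le> 1"
    and h: "\<Phi> (1, 0) = var1 + fst (linearization \<omega> F)" "\<Phi> (0, 1) = var2 + snd (linearization \<omega> F)"
    using linearization_linearizes[OF irr] by metis
  let ?R = "32 * exp rate"
  have le: "norm (coeff_at H \<alpha>) \<le> ?R ^ deg \<alpha>"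
    if e: "e \<in> units" and H: "\<And>\<alpha>. coeff_at (\<Phi> e) \<alpha> = (if \<alpha> = e then 1 else 0) + coeff_at H \<alpha>" for e H \<alpha>
  proof (cases "\<alpha> = e")
    case True
    then have "coeff_at H \<alpha> = 0" using H[of e] linearizes_low[OF \<Phi>(1) e, of e] deg_unit[OF e] by simp
    then show ?thesis by simp
  next
    case False
    then show ?thesis using H[of \<alpha>] linearizes_coeff_le[OF \<Phi> e, of \<alpha>] by simp
  qed
  have "ball 0 (1 / ?R) \<times> ball 0 (1 / ?R) \<subseteq> convergence_domain (linearization \<omega> F)"
  proof (rule polydisc_subset_convergence_domain)
    show "norm (coeff_at (fst (linearization \<omega> F)) \<alpha>) \<le> ?R ^ deg \<alpha>" for \<alpha>
    proof (rule le)
      show "(1, 0) \<in> units" by (simp add: units_def)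
      show "coeff_at (\<Phi> (1, 0)) \<alpha> = (if \<alpha> = (1, 0) then 1 else 0) + coeff_at (fst (linearization \<omega> F)) \<alpha>" for \<alpha>
        unfolding h coeff_at_add coeff_at_var ..
    qed
    show "norm (coeff_at (snd (linearization \<omega> F)) \<alpha>) \<le> ?R ^ deg \<alpha>" for \<alpha>
    proof (rule le)
      show "(0, 1) \<in> units" by (simp add: units_def)
      show "coeff_at (\<Phi> (0, 1)) \<alpha> = (if \<alpha> = (0, 1) then 1 else 0) + coeff_at (snd (linearization \<omega> F)) \<alpha>" for \<alpha>
        unfolding h coeff_at_add coeff_at_var ..
    qed
  qed simp
  then show "ereal (1 / ?R) \<le> boundary_dist \<omega> F" by (rule boundary_dist_ge) simp
qed

lemma ereal_log_ge:
  assumes "0 < r" "ereal r \<le> x"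
  shows "ereal (ln r) \<le> ereal_log x"
  using assms by (cases x) (auto simp: ereal_log_def)

section \<open>The lower bound\<close>

theorem theorem5p5:
  shows "\<exists>C :: real. \<forall>\<omega> :: real. \<omega> > 0 \<and> bruno_number \<omega> \<longrightarrow>
           ereal_log (family_dist \<omega>) \<ge> - bruno_function \<omega> - ereal C"
proof (intro exI allI impI)
  fix \<omega> :: real
  assume \<omega>: "\<omega> > 0 \<and> bruno_number \<omega>"
  then have irr: "\<omega> \<notin> \<rat>" by (simp add: bruno_number_def)
  let ?t = "\<lambda>j. - (cf_prod \<omega> j * ln (cf_rem \<omega> j))"
  have t: "0 \<le> ?t j" for j
    using cf_prod_pos[OF irr, of j] cf_rem_bounds[OF irr, of j]
    by (simp add: mult_nonneg_nonpos)
  have B: "bruno_function \<omega> = (\<Sum>j. ereal (?t j))"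
    by (simp add: bruno_function_def cf_prod_def)
  have partial: "ereal (\<Sum>j<L. ?t j) \<le> bruno_function \<omega>" for L
    unfolding B sum_ereal[symmetric] using t by (intro suminf_upper) (simp only: ereal_less_eq)
  show "ereal_log (family_dist \<omega>) \<ge> - bruno_function \<omega> - ereal (ln 32 + 4 + 25 * ln 2)"
  proof (cases "bruno_function \<omega>")
    case PInf
    then show ?thesis by simp
  next
    case MInf
    then show ?thesis using partial[of 0] by simp
  next
    case (real b)
    interpret bruno_bounded \<omega> b
      by unfold_locales (use irr \<omega> partial real in auto)
    have "ereal (ln (1 / (32 * exp rate))) \<le> ereal_log (family_dist \<omega>)"
      by (rule ereal_log_ge[OF _ family_dist_ge]) simp
    moreover have "ln (1 / (32 * exp rate)) = - b - (ln 32 + 4 + 25 * ln 2)"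
      by (simp add: ln_div ln_mult rate_def)
    ultimately show ?thesis using real by simp
  qed
qed

end
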